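(* Let $k>1$ be an integer with $k\equiv 1$ or $5 \pmod 6$. Then the $2$-skeleton of the $(k-1)$-simplex $\Delta^{k-1}$ decomposes into (i) $\frac{k-1}{2}$ collections of Möbius strips $$M_{l,k}:=\{(l:l:k-2l)\},\qquad 1\le l\le \tfrac{k-1}{2},$$ where $M_{l,k}$ has $n:=\gcd(l,k)$ isomorphic connected components on $\frac{k}{n}$ vertices each, and (ii) $\frac{k^2-6k+5}{12}$ collections of tori $$S_{l,j,k}:=\{(l:j:k-l-j),\,(l:k-l-j:j)\},\qquad 1\le l<j<k-l-j,$$ where $S_{l,j,k}$ has $m:=\gcd(l,j,k)$ connected components on $\frac{k}{m}$ vertices each.
   Context: For positive integers $a_0,\ldots,a_d$ with $n:=\sum_{i=0}^d a_i$, the difference cycle $(a_0:\ldots:a_d)$ of dimension $d$ on $n$ vertices is the simplicial complex on the vertex set $\mathbb{Z}_n=\{0,\ldots,n-1\}$ whose $d$-simplices are the orbit of $\{0,a_0,a_0+a_1,\ldots,\sum_{i=0}^{d-1}a_i\}$ under the cyclic $\mathbb{Z}_n$-action generated by the shift $v\mapsto v+1 \bmod n$ on subsets of $\mathbb{Z}_n$. A set of difference cycles on the same vertex set denotes the simplicial complex that is their union. The $2$-skeleton $\operatorname{skel}_2(\Delta^{k-1})$ of the $(k-1)$-simplex with vertices $0,\ldots,k-1$ is the set of all faces of dimension at most $2$; its triangles are all $3$-element subsets of $\{0,\ldots,k-1\}$. "Decomposes" means that every triangle belongs to exactly one complex of the listed families. A "collection of Möbius strips" (resp. tori) is a triangulated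 $2$-manifold each of whose connected components is a Möbius strip (resp. a torus $\mathbb{T}^2$). Isomorphic means combinatorially isomorphic, i.e. equal up to a relabeling of the vertices. *)

theory Defs
  imports "HOL-Analysis.Analysis"
begin

section \<open>Finite abstract simplicial complexes\<close>

text \<open>A complex is represented by the set of its nonempty faces; the empty face is never included.\<close>

definition abstract_complex :: "'a set set \<Rightarrow> bool" where
  "abstract_complex K \<longleftrightarrow> finite K \<and> (\<forall>\<sigma>\<in>K. finite \<sigma> \<and> \<sigma> \<noteq> {}) \<and>
     (\<forall>\<sigma>\<in>K. \<forall>\<tau>. \<tau> \<subseteq> \<sigma> \<and> \<tau> \<noteq> {} \<longrightarrow> \<tau> \<in> K)"

definition verts :: "'a set set \<Rightarrow> 'a set" where
  "verts K = \<Union>K"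

definition generated_complex :: "'a set set \<Rightarrow> 'a set set" where
  "generated_complex F = {\<tau>. \<tau> \<noteq> {} \<and> (\<exists>\<sigma>\<in>F. \<tau> \<subseteq> \<sigma>)}"

text \<open>\<open>full_simplex k\<close> is the simplex of dimension \<open>k - 1\<close> with vertices \<open>0, \<dots>, k - 1\<close>.\<close>

definition full_simplex :: "nat \<Rightarrow> nat set set" where
  "full_simplex k = generated_complex {{0..<k}}"

definition skel :: "nat \<Rightarrow> 'a set set \<Rightarrow> 'a set set" where
  "skel d K = {\<sigma>\<in>K. card \<sigma> \<le> d + 1}"

definition triangles :: "'a set set \<Rightarrow> 'a set set" where
  "triangles K = {\<sigma>\<in>K. card \<sigma> = 3}"

definition isomorphic_complexes :: "'a set set \<Rightarrow> 'b set set \<Rightarrow> bool" where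
  "isomorphic_complexes K L \<longleftrightarrow>
     (\<exists>f. bij_betw f (verts K) (verts L) \<and> (\<lambda>\<sigma>. f ` \<sigma>) ` K = L)"

definition edge_rel :: "'a set set \<Rightarrow> ('a \<times> 'a) set" where
  "edge_rel K = {(u, v). {u, v} \<in> K}"

text \<open>Connected components, as subcomplexes: the faces spanned by the vertices reachable from
  a given vertex along edges.\<close>

definition complex_components :: "'a set set \<Rightarrow> 'a set set set" where
  "complex_components K = (\<lambda>v. {\<sigma>\<in>K. \<sigma> \<subseteq> (edge_rel K)\<^sup>* `` {v}}) ` verts K"

definition decomposes :: "'a set set \<Rightarrow> 'a set set set \<Rightarrow> bool" where
  "decomposes K \<F> \<longleftrightarrow> (\<forall>L\<in>\<F>. L \<subseteq> K) \<and> (\<forall>\<sigma>\<in>triangles K. \<exists>!L. L \<in> \<F> \<and> \<sigma> \<in> L)"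

section \<open>Triangulated surfaces\<close>

text \<open>The geometric realization in barycentric coordinates: a point is a convex combination of
  vertices whose support is a face. For finite complexes the product topology induces the usual
  topology.\<close>

definition realization :: "'a set set \<Rightarrow> ('a \<Rightarrow> real) topology" where
  "realization K = subtopology (powertop_real UNIV)
     {x. (\<forall>v. 0 \<le> x v) \<and> {v. x v \<noteq> 0} \<in> K \<and> (\<Sum>v | x v \<noteq> 0. x v) = 1}"

definition second_countable_space :: "'a topology \<Rightarrow> bool" where
  "second_countable_space X \<longleftrightarrow> (\<exists>\<B>. countable \<B> \<and> (\<forall>V\<in>\<B>. openin X V) \<and>
     (\<forall>U x. openin X U \<and> x \<in> U \<longrightarrow> (\<exists>V\<in>\<B>. x \<in> V \<and> V \<subseteq> U)))"

definition half_plane :: "(real \<times> real) topology" where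
  "half_plane = top_of_set {p. 0 \<le> snd p}"

text \<open>Topological 2-manifolds, with possibly empty boundary.\<close>

definition two_manifold :: "'a topology \<Rightarrow> bool" where
  "two_manifold X \<longleftrightarrow> Hausdorff_space X \<and> second_countable_space X \<and>
     (\<forall>x\<in>topspace X. \<exists>U V. openin X U \<and> x \<in> U \<and> openin half_plane V \<and>
        subtopology X U homeomorphic_space subtopology half_plane V)"

definition torus :: "(complex \<times> complex) topology" where
  "torus = prod_topology (top_of_set (sphere 0 1)) (top_of_set (sphere 0 1))"

definition unit_square :: "(real \<times> real) set" where
  "unit_square = {0..1} \<times> {0..1}"

definition moebius_glue :: "((real \<times> real) \<times> (real \<times> real)) set" where
  "moebius_glue = {(p, q). p \<in> unit_square \<and> q \<in> unit_square \<and>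
     (p = q \<or> (\<exists>y. {p, q} = {(0, y), (1, 1 - y)}))}"

text \<open>The unit square with its left and right sides glued by a flip. The points are the
  equivalence classes and the topology is the quotient topology; see
  \<open>quotient_map_moebius_strip\<close> below.\<close>

definition moebius_strip :: "(real \<times> real) set topology" where
  "moebius_strip = topology (\<lambda>U. U \<subseteq> unit_square // moebius_glue \<and>
     openin (top_of_set unit_square) (\<Union>U))"

lemma equiv_moebius_glue: "equiv unit_square moebius_glue"
proof (rule equivI)
  show "moebius_glue \<subseteq> unit_square \<times> unit_square"
    by (auto simp: moebius_glue_def)
  show "refl_on unit_square moebius_glue"
    by (auto simp: moebius_glue_def refl_on_def)
  show "sym moebius_glue"
    by (auto simp: moebius_glue_def sym_def insert_commute)
  show "trans moebius_glue"
    by (auto simp: moebius_glue_def trans_def doubleton_eq_iff)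
qed

lemma openin_moebius_strip:
  "openin moebius_strip U \<longleftrightarrow>
     U \<subseteq> unit_square // moebius_glue \<and> openin (top_of_set unit_square) (\<Union>U)"
proof -
  have "istopology (\<lambda>U. U \<subseteq> unit_square // moebius_glue \<and>
      openin (top_of_set unit_square) (\<Union>U))" (is "istopology ?P")
    unfolding istopology_def
  proof (intro conjI allI impI)
    fix S T assume S: "?P S" and T: "?P T"
    show "S \<inter> T \<subseteq> unit_square // moebius_glue" using S by blast
    have "A = B" if "A \<in> S" "B \<in> T" "x \<in> A" "x \<in> B" for A B x
      using quotient_disj[OF equiv_moebius_glue, of A B] S T that by blast
    then have "\<Union>(S \<inter> T) = \<Union>S \<inter> \<Union>T" by blast
    then show "openin (top_of_set unit_square) (\<Union>(S \<inter> T))"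
      using S T by (simp add: openin_Int)
  next
    fix \<K> assume K: "\<forall>S\<in>\<K>. ?P S"
    then show "\<Union>\<K> \<subseteq> unit_square // moebius_glue" by blast
    have "\<Union>(\<Union>\<K>) = \<Union>((\<lambda>S. \<Union>S) ` \<K>)" by blast
    moreover have "openin (top_of_set unit_square) (\<Union>((\<lambda>S. \<Union>S) ` \<K>))"
      using K by (intro openin_Union) blast
    ultimately show "openin (top_of_set unit_square) (\<Union>(\<Union>\<K>))" by simp
  qed
  then show ?thesis by (simp add: moebius_strip_def)
qed

lemma topspace_moebius_strip: "topspace moebius_strip = unit_square // moebius_glue"
proof -
  have "openin moebius_strip (unit_square // moebius_glue)"
    by (simp add: openin_moebius_strip Union_quotient[OF equiv_moebius_glue])
  then show ?thesis
    by (meson openin_moebius_strip openin_subset openin_topspace subset_antisym)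
qed

lemma quotient_map_moebius_strip:
  "quotient_map (top_of_set unit_square) moebius_strip (\<lambda>p. moebius_glue `` {p})"
proof -
  have "{p \<in> unit_square. moebius_glue `` {p} \<in> U} = \<Union>U"
    if U: "U \<subseteq> unit_square // moebius_glue" for U
  proof
    show "{p \<in> unit_square. moebius_glue `` {p} \<in> U} \<subseteq> \<Union>U"
      using equiv_class_self[OF equiv_moebius_glue] by blast
    show "\<Union>U \<subseteq> {p \<in> unit_square. moebius_glue `` {p} \<in> U}"
    proof
      fix p assume "p \<in> \<Union>U"
      then obtain A where A: "A \<in> U" "p \<in> A" by blast
      then have AQ: "A \<in> unit_square // moebius_glue" using U by blast
      then have p: "p \<in> unit_square"
        using A in_quotient_imp_subset[OF equiv_moebius_glue] by blast
      have "moebius_glue `` {p} = A"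
        using quotient_disj[OF equiv_moebius_glue AQ quotientI[OF p]] A
          equiv_class_self[OF equiv_moebius_glue p] by blast
      then show "p \<in> {p \<in> unit_square. moebius_glue `` {p} \<in> U}" using A p by simp
    qed
  qed
  then show ?thesis
    unfolding quotient_map_def
    by (auto simp: topspace_moebius_strip openin_moebius_strip quotient_def)
qed

definition collection_of :: "'b topology \<Rightarrow> 'a set set \<Rightarrow> bool" where
  "collection_of X K \<longleftrightarrow> abstract_complex K \<and> two_manifold (realization K) \<and>
     (\<forall>C\<in>complex_components K. realization C homeomorphic_space X)"

section \<open>Difference cycles\<close>

text \<open>The difference cycle \<open>(a\<^sub>0 : \<dots> : a\<^sub>d)\<close> is given by the list \<open>[a\<^sub>0, \<dots>, a\<^sub>d]\<close> of positive
  integers; it lives on the vertex set \<open>{0..<sum_list a}\<close>.\<close>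

definition base_simplex :: "nat list \<Rightarrow> nat set" where
  "base_simplex a = (\<lambda>i. sum_list (take i a)) ` {..<length a}"

definition cyclic_shift :: "nat \<Rightarrow> nat set \<Rightarrow> nat set" where
  "cyclic_shift n \<sigma> = (\<lambda>v. (v + 1) mod n) ` \<sigma>"

definition difference_cycle :: "nat list \<Rightarrow> nat set set" where
  "difference_cycle a =
     generated_complex {(cyclic_shift (sum_list a) ^^ t) (base_simplex a) | t. True}"

definition M_complex :: "nat \<Rightarrow> nat \<Rightarrow> nat set set" where
  "M_complex l k = difference_cycle [l, l, k - 2 * l]"

definition S_complex :: "nat \<Rightarrow> nat \<Rightarrow> nat \<Rightarrow> nat set set" where
  "S_complex l j k = difference_cycle [l, j, k - l - j] \<union> difference_cycle [l, k - l - j, j]"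

definition M_family :: "nat \<Rightarrow> nat set set set" where
  "M_family k = {M_complex l k | l. 1 \<le> l \<and> l \<le> (k - 1) div 2}"

text \<open>The bound \<open>j < k - l - j\<close> forces \<open>l + 2 * j < k\<close>, so the truncated subtraction is harmless.\<close>

definition S_family :: "nat \<Rightarrow> nat set set set" where
  "S_family k = {S_complex l j k | l j. 1 \<le> l \<and> l < j \<and> j < k - l - j}"

end

theory Submission
  imports Defs
begin

text \<open>A 3-subset of \<open>\<int>\<^sub>k\<close> is determined up to shifts by its cyclic gap sequence \<open>(a, b, c)\<close>, where
  \<open>a + b + c = k\<close>, up to rotation; as \<open>3\<close> does not divide \<open>k\<close>, either exactly two gaps agree (a triangle of a Moebius
  collection) or all three differ (a triangle of a torus collection).

  For the topology, send the lattice point \<open>(a, b)\<close> to \<open>c + a l + b j\<close> and extend this affinely over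
  the triangulation of the plane with edge directions \<open>(1, 0)\<close>, \<open>(0, 1)\<close>, \<open>(1, 1)\<close>. If the six
  neighbours of a vertex are distinct, the open star of a vertex is an open hexagon on which this
  map has a linear inverse. This gives charts, and it shows that two points of the plane have the
  same image iff they differ by an element of the kernel lattice of \<open>\<int>\<^sup>2 \<rightarrow> \<int>\<^sub>k\<close>, so that the image
  is a torus. For \<open>j = l\<close> the triangles are already covered by the strip \<open>0 \<le> s - t \<le> 1\<close>, on
  which \<open>\<int>\<close> acts by glide reflections; the vertices are identified modulo the odd number
  \<open>k / gcd l k\<close>, so the ends of a fundamental domain are glued with a flip.\<close>

text \<open>For \<open>j = l\<close> the neighbours \<open>(1, 0)\<close> and \<open>(0, 1)\<close>
  carry the same label, so the map folds the plane along diagonals and hexagons are no longer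
  charts. The strip therefore gets half-hexagon charts, whose straight edge is the boundary of the
  surface. Apart from charts and fibres, both families are treated at once as instances of
  \<open>cyc k l j\<close>. That \<open>k\<close> is prime to 6 also matters locally: the labels
  around a vertex could coincide through \<open>k\<close> dividing twice some number below
  \<open>k\<close>, or a multiple of \<open>l\<close> by 2, 3 or 4, and coprimality removes these
  factors. No inverse of the global map is built. Two points with the same image share a vertex of
  positive weight; this moves both into one star, where injectivity is known, and so settles the
  fibres. The realization, as a Hausdorff image of a compact square, and the model surface are then
  two quotients of that square with equal fibres.\<close>

definition vx :: "nat \<Rightarrow> int \<Rightarrow> nat" where
  "vx k z = nat (z mod int k)"

text \<open>Only two gaps are recorded; the third is \<open>k - a - b\<close>. The base point
  \<open>t\<close> ranges over all integers, so shifts need no wraparound.\<close>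

definition tri :: "nat \<Rightarrow> nat \<Rightarrow> nat \<Rightarrow> int \<Rightarrow> nat set" where
  "tri k a b t = {vx k t, vx k (t + int a), vx k (t + int a + int b)}"

text \<open>The cycle \<open>(l : k-l-j : j)\<close> rotates to \<open>(j : l : k-l-j)\<close>,
  which removes the third gap and makes the union symmetric in \<open>l\<close> and
  \<open>j\<close>. For \<open>j = l\<close> both generators coincide and the Moebius complexes are
  included.\<close>

definition cyc :: "nat \<Rightarrow> nat \<Rightarrow> nat \<Rightarrow> nat set set" where
  "cyc k l j = generated_complex (range (tri k l j) \<union> range (tri k j l))"

definition res_class :: "nat \<Rightarrow> nat \<Rightarrow> int \<Rightarrow> nat set" where
  "res_class k m c = {w. w < k \<and> int m dvd int w - c}"

definition cyc_comp :: "nat \<Rightarrow> nat \<Rightarrow> nat \<Rightarrow> int \<Rightarrow> nat set set" where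
  "cyc_comp k l j c = {\<sigma> \<in> cyc k l j. \<sigma> \<subseteq> res_class k (gcd l (gcd j k)) c}"

section \<open>Residues modulo \<open>k\<close> and difference cycles as orbits of triangles\<close>

lemma vx_less: "k > 0 \<Longrightarrow> vx k z < k"
  by (simp add: vx_def nat_less_iff)

lemma int_vx: "k > 0 \<Longrightarrow> int (vx k z) = z mod int k"
  by (simp add: vx_def)

lemma vx_eq_iff: "k > 0 \<Longrightarrow> vx k y = vx k z \<longleftrightarrow> int k dvd y - z"
  by (metis int_vx mod_eq_dvd_iff of_nat_eq_iff)

lemma vx_of_nat [simp]: "v < k \<Longrightarrow> vx k (int v) = v"
  by (simp add: vx_def)

lemma vx_add_vx: "k > 0 \<Longrightarrow> vx k (int (vx k y) + z) = vx k (y + z)"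
  by (simp add: vx_def mod_add_left_eq)

lemma tri_shift: "k > 0 \<Longrightarrow> (\<lambda>w. vx k (int w + d)) ` tri k a b t = tri k a b (t + d)"
  by (simp add: tri_def vx_add_vx) (simp add: algebra_simps)

lemma tri_mod: "k > 0 \<Longrightarrow> tri k a b (t mod int k) = tri k a b t"
  unfolding tri_def by (simp add: vx_def mod_add_left_eq add.assoc)

lemma tri_subset: "k > 0 \<Longrightarrow> tri k a b t \<subseteq> {..<k}"
  by (auto simp: tri_def vx_less)

lemma difference_cycle_3:
  assumes "k > 0" "c > 0" "a + b + c = k"
  shows "difference_cycle [a, b, c] = generated_complex (range (tri k a b))"
proof -
  have eq: "{..<3::nat} = {0, 1, 2}" by auto
  have base: "base_simplex [a, b, c] = tri k a b 0"
    using assms by (auto simp: base_simplex_def eq tri_def vx_def numeral_2_eq_2 numeral_3_eq_3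
        lessThan_Suc nat_mod_as_int)
  have shift: "cyclic_shift k (tri k a b t) = tri k a b (t + 1)" for t
  proof -
    have "(v + 1) mod k = vx k (int v + 1)" for v
      by (simp add: vx_def nat_mod_as_int add.commute)
    then show ?thesis
      unfolding cyclic_shift_def using tri_shift[OF assms(1), of 1] by simp
  qed
  have pow: "(cyclic_shift k ^^ t) (base_simplex [a, b, c]) = tri k a b (int t)" for t
    by (induction t) (simp_all add: base shift add.commute)
  \<comment> \<open>Iterated shifts only reach base points \<open>int t\<close>; negative base
    points are recovered by reduction modulo \<open>k\<close>.\<close>
  have "range (tri k a b) = (\<lambda>t. tri k a b (int t)) ` UNIV"
  proof -
    have "range (tri k a b) \<subseteq> range (\<lambda>t. tri k a b (int t))"
    proof (rule image_subsetI)
      show "tri k a b t \<in> range (\<lambda>t. tri k a b (int t))" for t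
        by (rule image_eqI[of _ _ "nat (t mod int k)"]) (use assms in \<open>simp_all add: tri_mod\<close>)
    qed
    then show ?thesis by blast
  qed
  then show ?thesis
    using assms by (simp add: difference_cycle_def pow add.assoc[symmetric] full_SetCompr_eq)
qed

text \<open>Starting the same triangle at its second vertex rotates the gaps; the path closes up
  because they add up to \<open>k\<close>.\<close>

lemma tri_rotate:
  assumes "k > 0" "a + b + c = k"
  shows "tri k b c (t + int a) = tri k a b t"
proof -
  have "vx k (t + int a + int b + int c) = vx k t"
    using assms by (subst vx_eq_iff) (auto simp flip: of_nat_add simp: add.assoc)
  then show ?thesis by (auto simp: tri_def)
qed

lemma generated_complex_Un:
  "generated_complex (A \<union> B) = generated_complex A \<union> generated_complex B"
  by (auto simp: generated_complex_def)

lemma M_complex_eq_cyc: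
  assumes "0 < l" "2 * l < k"
  shows "M_complex l k = cyc k l l"
  using assms by (simp add: M_complex_def cyc_def difference_cycle_3)

lemma range_tri_rotate:
  assumes "k > 0" "a + b + c = k"
  shows "range (tri k b c) = range (tri k a b)"
proof -
  have "tri k b c t = tri k a b (t - int a)" for t
    using tri_rotate[OF assms, of "t - int a"] by simp
  then have "range (tri k b c) \<subseteq> range (tri k a b)"
    by (intro image_subsetI) (simp only: rangeI)
  moreover have "range (tri k a b) \<subseteq> range (tri k b c)"
    unfolding tri_rotate[OF assms, symmetric] by blast
  ultimately show ?thesis by (rule subset_antisym)
qed

lemma S_complex_eq_cyc:
  assumes "0 < l" "0 < j" "l + j < k"
  shows "S_complex l j k = cyc k l j"
proof -
  have "range (tri k l (k - l - j)) = range (tri k j l)"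
    using assms by (intro range_tri_rotate) auto
  moreover have "difference_cycle [l, k - l - j, j] = generated_complex (range (tri k l (k - l - j)))"
    using assms by (intro difference_cycle_3) auto
  moreover have "difference_cycle [l, j, k - l - j] = generated_complex (range (tri k l j))"
    using assms by (intro difference_cycle_3) auto
  ultimately show ?thesis
    by (simp only: S_complex_def cyc_def generated_complex_Un)
qed

lemma mem_cyc:
  "\<sigma> \<in> cyc k l j \<longleftrightarrow> \<sigma> \<noteq> {} \<and> (\<exists>z. \<sigma> \<subseteq> tri k l j z \<or> \<sigma> \<subseteq> tri k j l z)"
  unfolding cyc_def generated_complex_def by blast

lemma cyc_subset: "k > 0 \<Longrightarrow> \<sigma> \<in> cyc k l j \<Longrightarrow> \<sigma> \<subseteq> {..<k}"
  unfolding mem_cyc by (meson order_trans tri_subset)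

lemma card_cyc: "\<sigma> \<in> cyc k l j \<Longrightarrow> card \<sigma> \<le> 3"
proof -
  have "card (tri k a b z) \<le> 3" "finite (tri k a b z)" for a b z
    unfolding tri_def by (auto simp: card_insert_if)
  then show "\<sigma> \<in> cyc k l j \<Longrightarrow> card \<sigma> \<le> 3"
    unfolding mem_cyc by (meson card_mono le_trans)
qed

lemma finite_cyc: "k > 0 \<Longrightarrow> finite (cyc k l j)"
  by (rule finite_subset[of _ "Pow {..<k}"]) (auto dest: cyc_subset)

lemma abstract_complex_cyc: "k > 0 \<Longrightarrow> abstract_complex (cyc k l j)"
  unfolding abstract_complex_def
proof (intro conjI ballI allI impI)
  fix \<sigma> \<tau> assume "\<sigma> \<in> cyc k l j" "\<tau> \<subseteq> \<sigma> \<and> \<tau> \<noteq> {}"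
  then show "\<tau> \<in> cyc k l j" unfolding mem_cyc by (meson order_trans)
qed (auto simp: finite_cyc mem_cyc tri_def intro: finite_subset)

lemma verts_cyc: "k > 0 \<Longrightarrow> verts (cyc k l j) = {..<k}"
proof
  show "k > 0 \<Longrightarrow> verts (cyc k l j) \<subseteq> {..<k}"
    by (auto simp: verts_def dest: cyc_subset)
  have "{w} \<in> cyc k l j" if "w < k" for w
    using that by (auto simp: mem_cyc tri_def intro!: exI[of _ "int w"])
  then show "{..<k} \<subseteq> verts (cyc k l j)"
    by (auto simp: verts_def)
qed

section \<open>Connected components as residue classes\<close>

lemma tri_res:
  assumes "k > 0" "m dvd k" "m dvd a" "m dvd b" "u \<in> tri k a b z"
  shows "int m dvd int u - z"
proof -
  have *: "int m dvd int (vx k (z + int e)) - z" if "m dvd e" for e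
  proof -
    have "int k dvd int (vx k (z + int e)) - (z + int e)"
      using assms(1) by (simp add: int_vx mod_eq_dvd_iff[symmetric])
    then have "int m dvd int (vx k (z + int e)) - (z + int e)"
      using assms(2) by (meson dvd_trans of_nat_dvd_iff)
    then have "int m dvd (int (vx k (z + int e)) - (z + int e)) + int e"
      using that by (intro dvd_add) auto
    then show ?thesis by simp
  qed
  show ?thesis
    using assms(5) *[of 0] *[of a] *[of "a + b"] assms(3,4)
    by (auto simp: tri_def add.assoc)
qed

lemma cyc_face_res:
  assumes "k > 0" "\<sigma> \<in> cyc k l j" "u \<in> \<sigma>" "v \<in> \<sigma>"
  shows "int (gcd l (gcd j k)) dvd int u - int v"
proof -
  let ?m = "gcd l (gcd j k)"
  have m: "?m dvd k" "?m dvd l" "?m dvd j" by (auto intro: dvd_trans[OF gcd_dvd2])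
  obtain z where z: "\<sigma> \<subseteq> tri k l j z \<or> \<sigma> \<subseteq> tri k j l z"
    using assms(2) by (auto simp: mem_cyc)
  have "int ?m dvd int w - z" if "w \<in> \<sigma>" for w
    using that z tri_res[OF assms(1) m, of w z] tri_res[OF assms(1) m(1,3,2), of w z] by blast
  from dvd_diff[OF this[OF assms(3)] this[OF assms(4)]] show ?thesis by simp
qed

text \<open>Two Bezout identities, first for \<open>gcd j k\<close> and then for its gcd with
  \<open>l\<close>, write the modulus as a combination of \<open>l\<close>, \<open>j\<close> and
  \<open>k\<close>; the multiple of \<open>k\<close> disappears in \<open>vx\<close>.\<close>

lemma res_class_lattice:
  assumes "k > 0" "w \<in> res_class k (gcd l (gcd j k)) c"
  obtains a b where "w = vx k (c + a * int l + b * int j)"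
proof -
  let ?m = "gcd l (gcd j k)"
  have w: "w < k" "int ?m dvd int w - c"
    using assms(2) by (auto simp: res_class_def)
  obtain x y where xy: "x * int j + y * int k = int (gcd j k)"
    using bezout_int[of "int j" "int k"] by auto
  obtain p q where pq: "p * int l + q * int (gcd j k) = int ?m"
    using bezout_int[of "int l" "int (gcd j k)"] by auto
  obtain e where e: "int w - c = int ?m * e" using w(2) by auto
  have "int w - (c + (e * p) * int l + (e * q * x) * int j) = int k * (e * q * y)"
    using e pq[symmetric] xy[symmetric] by (simp add: algebra_simps)
  then have "int k dvd int w - (c + (e * p) * int l + (e * q * x) * int j)" by simp
  then have "vx k (int w) = vx k (c + (e * p) * int l + (e * q * x) * int j)"
    using assms(1) by (simp add: vx_eq_iff)
  then show ?thesis using w(1) that by simp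
qed

lemma lattice_res_class:
  assumes "k > 0"
  shows "vx k (c + a * int l + b * int j) \<in> res_class k (gcd l (gcd j k)) c"
proof -
  let ?m = "gcd l (gcd j k)" and ?z = "c + a * int l + b * int j"
  have "int ?m dvd int k" "int ?m dvd int l" "int ?m dvd int j"
    by (auto simp: int_dvd_int_iff intro: dvd_trans[OF gcd_dvd2])
  moreover have "int k dvd int (vx k ?z) - ?z"
    using assms by (simp add: int_vx mod_eq_dvd_iff[symmetric])
  ultimately have "int ?m dvd (int (vx k ?z) - ?z) + (a * int l + b * int j)"
    by (intro dvd_add) (auto intro: dvd_trans)
  then show ?thesis using assms by (simp add: res_class_def vx_less)
qed

text \<open>All vertices of a face agree modulo the gcd, so paths stay in one class. Conversely any
  member of the class is reached by a walk of steps \<open>l\<close> followed by a walk of steps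
  \<open>j\<close>.\<close>

lemma edge_rtrancl_cyc:
  assumes "k > 0" "v < k"
  shows "(edge_rel (cyc k l j))\<^sup>* `` {v} = res_class k (gcd l (gcd j k)) (int v)"
proof (intro subset_antisym subsetI)
  let ?m = "gcd l (gcd j k)" and ?R = "edge_rel (cyc k l j)"
  fix w assume "w \<in> ?R\<^sup>* `` {v}"
  then have "(v, w) \<in> ?R\<^sup>*" by simp
  then show "w \<in> res_class k ?m (int v)"
  proof (induction rule: rtrancl_induct)
    case base
    show ?case using assms by (simp add: res_class_def)
  next
    case (step y z)
    then have yz: "{y, z} \<in> cyc k l j" by (simp add: edge_rel_def)
    have "int ?m dvd int z - int y" "z < k"
      using cyc_face_res[OF assms(1) yz] cyc_subset[OF assms(1) yz] by auto
    then have "int ?m dvd (int z - int y) + (int y - int v)" 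
      using step.IH by (intro dvd_add) (auto simp: res_class_def)
    then show ?case using \<open>z < k\<close> by (simp add: res_class_def)
  qed
next
  let ?R = "edge_rel (cyc k l j)"
  fix w assume "w \<in> res_class k (gcd l (gcd j k)) (int v)"
  then obtain a b where w: "w = vx k (int v + a * int l + b * int j)"
    using res_class_lattice[OF assms(1)] by blast
  have e: "(vx k z, vx k (z + int l)) \<in> ?R" "(vx k (z + int l), vx k z) \<in> ?R" 
     "(vx k z, vx k (z + int j)) \<in> ?R" "(vx k (z + int j), vx k z) \<in> ?R" for z
    by (auto simp: edge_rel_def mem_cyc tri_def)
  \<comment> \<open>A walk of \<open>a\<close> equal steps, backwards when \<open>a\<close> is
    negative; hence both orientations of the edge are required and the induction runs in both
    directions.\<close>
  have A: "(vx k z, vx k (z + a * int d)) \<in> ?R\<^sup>*"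
    if d: "\<And>z. (vx k z, vx k (z + int d)) \<in> ?R" "\<And>z. (vx k (z + int d), vx k z) \<in> ?R" for a z d
  proof (induction a rule: int_induct[where k = 0])
    case base
    show ?case by simp
  next
    case (step1 i)
    then show ?case using d(1)[of "z + i * int d"]
      by (auto simp: algebra_simps intro: rtrancl.rtrancl_into_rtrancl)
  next
    case (step2 i)
    then show ?case using d(2)[of "z + (i - 1) * int d"]
      by (auto simp: algebra_simps intro: rtrancl.rtrancl_into_rtrancl)
  qed
  have "(vx k (int v), vx k (int v + a * int l)) \<in> ?R\<^sup>*" using e by (intro A)
  moreover have "(vx k (int v + a * int l), w) \<in> ?R\<^sup>*" unfolding w using e by (intro A)
  ultimately show "w \<in> ?R\<^sup>* `` {v}" using assms by auto
qed

lemma complex_components_cyc: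
  assumes "k > 0"
  shows "complex_components (cyc k l j) = (\<lambda>v. cyc_comp k l j (int v)) ` {..<k}"
  unfolding complex_components_def verts_cyc[OF assms] cyc_comp_def
  using edge_rtrancl_cyc[OF assms] by simp

lemma verts_cyc_comp:
  assumes "k > 0"
  shows "verts (cyc_comp k l j c) = res_class k (gcd l (gcd j k)) c"
proof -
  have "{w} \<in> cyc k l j" if "w < k" for w
    using that by (auto simp: mem_cyc tri_def intro!: exI[of _ "int w"])
  then show ?thesis by (auto simp: verts_def cyc_comp_def res_class_def)
qed

lemma res_class_eq_iff:
  assumes "k > 0" "m dvd k"
  shows "res_class k m c = res_class k m d \<longleftrightarrow> int m dvd c - d"
proof
  assume eq: "res_class k m c = res_class k m d"
  have "int m dvd int (vx k c) - c"
    using assms by (metis dvd_trans int_vx mod_eq_dvd_iff mod_mod_trivial of_nat_dvd_iff)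
  then have "vx k c \<in> res_class k m c" using assms by (simp add: res_class_def vx_less)
  then have "int m dvd int (vx k c) - c" "int m dvd int (vx k c) - d"
    using eq by (auto simp: res_class_def)
  from dvd_diff[OF this(2,1)] show "int m dvd c - d" by simp
next
  assume "int m dvd c - d"
  then have "int m dvd x - c \<longleftrightarrow> int m dvd x - d" for x
    using dvd_add_right_iff[of "int m" "c - d" "x - c"] by simp
  then show "res_class k m c = res_class k m d" by (simp add: res_class_def)
qed

lemma card_res_class:
  assumes "k > 0" "m dvd k"
  shows "card (res_class k m c) = k div m"
proof -
  have m: "m > 0" using assms by (auto intro: Nat.gr0I)
  \<comment> \<open>The least nonnegative representative: below \<open>k\<close> the class is the
    progression \<open>e\<close>, \<open>e + m\<close>, ... with \<open>k div m\<close>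
    terms.\<close>
  define e where "e = nat (c mod int m)"
  have e: "int e = c mod int m" "e < m" using m by (auto simp: e_def nat_less_iff)
  have "int m dvd c - int e" using e by (simp add: minus_mod_eq_mult_div [symmetric])
  then have "res_class k m c = res_class k m (int e)"
    using assms by (simp add: res_class_eq_iff)
  also have "\<dots> = (\<lambda>i. e + m * i) ` {..<k div m}"
  proof (intro subset_antisym subsetI)
    fix w assume "w \<in> res_class k m (int e)"
    then have w: "w < k" "w mod m = e"
      using e(2) by (auto simp: res_class_def mod_eq_dvd_iff[symmetric] simp flip: zmod_int)
    have "w = e + m * (w div m)" using w by (metis mod_mult_div_eq)
    moreover have "w div m < k div m" using w(1) assms m
      by (metis div_less_iff_less_mult dvd_div_mult_self)
    ultimately show "w \<in> (\<lambda>i. e + m * i) ` {..<k div m}" by blast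
  next
    fix w assume "w \<in> (\<lambda>i. e + m * i) ` {..<k div m}"
    then obtain i where i: "w = e + m * i" "i < k div m" by auto
    have "m * (i + 1) \<le> k" using i(2) assms by (metis Suc_eq_plus1 Suc_leI dvd_mult_div_cancel mult_le_mono2)
    then show "w \<in> res_class k m (int e)" using i e by (auto simp: res_class_def)
  qed
  also have "card \<dots> = k div m"
    using m by (subst card_image) (auto simp: inj_on_def)
  finally show ?thesis .
qed

text \<open>The components are indexed redundantly by all \<open>k\<close> vertices. The residues
  below the gcd are representatives, and different ones give components with different vertex
  sets.\<close>

lemma card_complex_components_cyc:
  assumes "k > 0"
  shows "card (complex_components (cyc k l j)) = gcd l (gcd j k)"
proof -
  let ?m = "gcd l (gcd j k)"
  have m: "?m dvd k" "?m > 0" using assms by (auto intro: dvd_trans[OF gcd_dvd2])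
  have "(\<lambda>v. cyc_comp k l j (int v)) ` {..<k} = (\<lambda>v. cyc_comp k l j (int v)) ` {..<?m}"
  proof -
    have "cyc_comp k l j (int v) = cyc_comp k l j (int (v mod ?m))" for v
    proof -
      have "int ?m dvd int v - int (v mod ?m)" by (simp add: zmod_int minus_mod_eq_mult_div)
      then show ?thesis unfolding cyc_comp_def using res_class_eq_iff[OF assms m(1)] by metis
    qed
    moreover have "v mod ?m \<in> {..<?m}" for v using m by simp
    ultimately have "(\<lambda>v. cyc_comp k l j (int v)) ` {..<k} \<subseteq> (\<lambda>v. cyc_comp k l j (int v)) ` {..<?m}"
      by blast
    moreover have "?m \<le> k" using m assms by (simp add: dvd_imp_le)
    ultimately show ?thesis by (auto simp: image_subset_iff)
  qed
  moreover have "inj_on (\<lambda>v. cyc_comp k l j (int v)) {..<?m}"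
  proof (rule inj_onI)
    fix v w assume vw: "v \<in> {..<?m}" "w \<in> {..<?m}" "cyc_comp k l j (int v) = cyc_comp k l j (int w)"
    then have "res_class k ?m (int v) = res_class k ?m (int w)"
      using verts_cyc_comp[OF assms] by metis
    then have "int ?m dvd int v - int w" using res_class_eq_iff[OF assms m(1)] by blast
    then have "v mod ?m = w mod ?m" by (metis mod_eq_dvd_iff of_nat_eq_iff zmod_int)
    then show "v = w" using vw by auto
  qed
  ultimately show ?thesis
    by (simp add: complex_components_cyc[OF assms] card_image)
qed

text \<open>Translation by \<open>d - c\<close> does it, because \<open>cyc k l j\<close> is
  invariant under every translation of the residues modulo \<open>k\<close>.\<close>

lemma isomorphic_cyc_comp:
  assumes "k > 0"
  shows "isomorphic_complexes (cyc_comp k l j c) (cyc_comp k l j d)"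
proof -
  let ?m = "gcd l (gcd j k)"
  define f where "f e = (\<lambda>w. vx k (int w + e))" for e
  have m: "?m dvd k" by (auto intro: dvd_trans[OF gcd_dvd2])
  have cls: "f (d - c) w \<in> res_class k ?m d" if "w \<in> res_class k ?m c" for w c d
  proof -
    have "int k dvd int (f (d - c) w) - (int w + (d - c))"
      using assms by (simp add: f_def int_vx mod_eq_dvd_iff[symmetric])
    moreover have "int ?m dvd int k" using m by (simp only: int_dvd_int_iff)
    ultimately have "int ?m dvd int (f (d - c) w) - (int w + (d - c))" by (rule dvd_trans[rotated])
    then have "int ?m dvd (int (f (d - c) w) - (int w + (d - c))) + (int w - c)"
      using that by (intro dvd_add) (simp_all add: res_class_def)
    then show ?thesis using assms by (simp add: res_class_def f_def vx_less)
  qed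
  have inv: "f (- e) (f e w) = w" if "w < k" for e w
    using that assms vx_add_vx[of k "int w + e" "- e"] by (simp add: f_def)
  have face: "f e ` \<sigma> \<in> cyc k l j" if "\<sigma> \<in> cyc k l j" for \<sigma> e
  proof -
    have "f e ` tri k a b z = tri k a b (z + e)" for a b z
      using tri_shift[OF assms] by (simp add: f_def)
    moreover obtain z where "\<sigma> \<noteq> {}" "\<sigma> \<subseteq> tri k l j z \<or> \<sigma> \<subseteq> tri k j l z"
      using \<open>\<sigma> \<in> cyc k l j\<close> unfolding mem_cyc by blast
    ultimately have "f e ` \<sigma> \<subseteq> tri k l j (z + e) \<or> f e ` \<sigma> \<subseteq> tri k j l (z + e)"
      by (metis image_mono)
    with \<open>\<sigma> \<noteq> {}\<close> show ?thesis unfolding mem_cyc image_is_empty by (intro conjI exI)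
  qed
  have comp: "f (d - c) ` \<sigma> \<in> cyc_comp k l j d" if "\<sigma> \<in> cyc_comp k l j c" for \<sigma> c d
    using that face cls by (auto simp: cyc_comp_def)
  have "bij_betw (f (d - c)) (res_class k ?m c) (res_class k ?m d)"
  proof (rule bij_betw_byWitness[where f' = "f (c - d)"])
    have "w < k" if "w \<in> res_class k ?m e" for w e using that by (simp add: res_class_def)
    then show "\<forall>w\<in>res_class k ?m c. f (c - d) (f (d - c) w) = w"
        "\<forall>w\<in>res_class k ?m d. f (d - c) (f (c - d) w) = w"
      using inv[of _ "d - c"] inv[of _ "c - d"] by simp_all
  qed (rule image_subsetI, erule cls)+
  moreover have "(\<lambda>\<sigma>. f (d - c) ` \<sigma>) ` cyc_comp k l j c = cyc_comp k l j d"
  proof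
    show "(\<lambda>\<sigma>. f (d - c) ` \<sigma>) ` cyc_comp k l j c \<subseteq> cyc_comp k l j d" using comp by auto
    show "cyc_comp k l j d \<subseteq> (\<lambda>\<sigma>. f (d - c) ` \<sigma>) ` cyc_comp k l j c"
    proof
      fix \<sigma> assume \<sigma>: "\<sigma> \<in> cyc_comp k l j d"
      have "f (d - c) ` f (c - d) ` \<sigma> = \<sigma>"
      proof -
        have "f (d - c) (f (c - d) w) = w" if "w \<in> \<sigma>" for w
          using that cyc_subset[OF assms, of \<sigma> l j] \<sigma> inv[of w "c - d"] by (auto simp: cyc_comp_def)
        then show ?thesis by (simp add: image_image)
      qed
      then show "\<sigma> \<in> (\<lambda>\<sigma>. f (d - c) ` \<sigma>) ` cyc_comp k l j c"
        by (intro image_eqI[OF _ comp[OF \<sigma>, of c]]) simp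
    qed
  qed
  ultimately show ?thesis
    unfolding isomorphic_complexes_def verts_cyc_comp[OF assms] by (intro exI conjI)
qed

section \<open>The decomposition and the number of complexes\<close>

lemma tri_eq_image: "tri k a b t = (\<lambda>x. vx k (t + int x)) ` {0, a, a + b}"
  by (simp add: tri_def add.assoc)

lemma tri_eq_same_base:
  assumes "0 < a" "0 < b" "a + b < k" "0 < a'" "0 < b'" "a' + b' < k"
    and "tri k a b t = tri k a' b' t"
  shows "a' = a \<and> b' = b"
proof -
  have "inj_on (\<lambda>x. vx k (t + int x)) {..<k}"
  proof (rule inj_onI)
    fix x y assume xy: "x \<in> {..<k}" "y \<in> {..<k}" "vx k (t + int x) = vx k (t + int y)"
    then have "int k dvd int x - int y" using assms by (simp add: vx_eq_iff)
    then have "x mod k = y mod k" by (metis mod_eq_dvd_iff of_nat_eq_iff zmod_int)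
    then show "x = y" using xy by simp
  qed
  then have "{0, a, a + b} = {0, a', a' + b'}"
    using assms unfolding tri_eq_image by (subst (asm) inj_on_image_eq_iff) auto
  then have "{a, a + b} = {a', a' + b'}"
    using assms by (metis insert_ident add_is_0 insertE less_irrefl singletonD)
  \<comment> \<open>The crossed matching of the two pairs would give \<open>a = a + b + b'\<close>,
    impossible for positive gaps.\<close>
  then show ?thesis using assms by (auto simp: doubleton_eq_iff)
qed

text \<open>The base vertex of the second triangle is one of three vertices of the first. Rotating
  the first to start there gives a common base, from which the gaps can be read off.\<close>

lemma tri_eqD:
  assumes "0 < a" "0 < b" "a + b < k" "0 < a'" "0 < b'" "a' + b' < k"
    and "tri k a b t = tri k a' b' t'"
  shows "(a', b') \<in> {(a, b), (b, k - a - b), (k - a - b, a)}"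
proof -
  let ?c = "k - a - b"
  have k: "k > 0" "a + b + ?c = k" "b + ?c + a = k" using assms by auto
  have rot: "tri k b ?c (t + int a) = tri k a b t"
    "tri k ?c a (t + int a + int b) = tri k a b t"
    using tri_rotate[OF k(1,2)] tri_rotate[OF k(1,3), of "t + int a"] by auto
  have base: "tri k a' b' t' = tri k a' b' s" if "vx k t' = vx k s" for s
  proof -
    have "t' mod int k = s mod int k" using that k(1) by (metis int_vx)
    then show ?thesis using tri_mod[OF k(1)] by metis
  qed
  have "vx k t' \<in> tri k a b t" unfolding assms(7) by (simp add: tri_def)
  then consider "vx k t' = vx k t" | "vx k t' = vx k (t + int a)"
    | "vx k t' = vx k (t + int a + int b)" by (auto simp: tri_def)
  then show ?thesis
  proof cases
    case 1
    have "tri k a b t = tri k a' b' t" using assms(7) base[OF 1] by simp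
    from tri_eq_same_base[OF assms(1-6) this] show ?thesis by simp
  next
    case 2
    have "tri k b ?c (t + int a) = tri k a' b' (t + int a)" using assms(7) base[OF 2] rot by simp
    from tri_eq_same_base[OF _ _ _ assms(4-6) this] assms show ?thesis by simp
  next
    case 3
    have "tri k ?c a (t + int a + int b) = tri k a' b' (t + int a + int b)"
      using assms(7) base[OF 3] rot by simp
    from tri_eq_same_base[OF _ _ _ assms(4-6) this] assms show ?thesis by simp
  qed
qed

lemma card_tri:
  assumes "0 < a" "0 < b" "a + b < k"
  shows "card (tri k a b t) = 3"
proof -
  have "\<not> int k dvd int x" if "0 < x" "x < k" for x using that by (simp add: nat_dvd_not_less)
  note d = this[of a] this[of b] this[of "a + b"]
  have "vx k t \<noteq> vx k (t + int a)" "vx k t \<noteq> vx k (t + int a + int b)"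
    "vx k (t + int a) \<noteq> vx k (t + int a + int b)"
    using d assms dvd_minus_iff[of "int k" "int a + int b"] by (auto simp: vx_eq_iff)
  then show ?thesis by (simp add: tri_def)
qed

text \<open>A face with three vertices is a whole generating triangle, so membership amounts to
  equality of gap sequences up to rotation and exchange of \<open>l\<close> and
  \<open>j\<close>.\<close>

lemma tri_mem_cyc_iff:
  assumes "0 < a" "0 < b" "a + b < k" "0 < l" "0 < j" "l + j < k"
  shows "tri k a b t \<in> cyc k l j \<longleftrightarrow>
    (\<exists>p\<in>{(a, b), (b, k - a - b), (k - a - b, a)}. p = (l, j) \<or> p = (j, l))"
proof
  assume "tri k a b t \<in> cyc k l j"
  then obtain z where z: "tri k a b t \<subseteq> tri k l j z \<or> tri k a b t \<subseteq> tri k j l z"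
    by (auto simp: mem_cyc)
  have card: "card (tri k a b t) = 3" "card (tri k l j z) = 3" "card (tri k j l z) = 3"
    using assms by (auto intro: card_tri)
  then have "tri k a b t = tri k l j z \<or> tri k a b t = tri k j l z"
  proof -
    have "finite (tri k x y z)" for x y by (simp add: tri_def)
    then show ?thesis
      using z card card_subset_eq[of "tri k l j z" "tri k a b t"]
        card_subset_eq[of "tri k j l z" "tri k a b t"] by auto
  qed
  then show "\<exists>p\<in>{(a, b), (b, k - a - b), (k - a - b, a)}. p = (l, j) \<or> p = (j, l)"
    using tri_eqD[OF assms, of t z] tri_eqD[OF assms(1-3,5,4), of t z] assms(6)
    by (auto simp only: add.commute)
next
  let ?c = "k - a - b"
  have k: "k > 0" "a + b + ?c = k" "b + ?c + a = k" using assms by auto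
  have rot: "tri k a b t = tri k b ?c (t + int a)"
    "tri k a b t = tri k ?c a (t + int a + int b)"
    using tri_rotate[OF k(1,2)] tri_rotate[OF k(1,3), of "t + int a"] by auto
  have mem: "tri k l j z \<in> cyc k l j" "tri k j l z \<in> cyc k l j" for z
    by (auto simp: mem_cyc tri_def)
  assume "\<exists>p\<in>{(a, b), (b, ?c), (?c, a)}. p = (l, j) \<or> p = (j, l)"
  then consider "(a, b) = (l, j)" | "(a, b) = (j, l)" | "(b, ?c) = (l, j)" | "(b, ?c) = (j, l)"
    | "(?c, a) = (l, j)" | "(?c, a) = (j, l)" by blast
  then show "tri k a b t \<in> cyc k l j"
    using mem[of t] mem[of "t + int a"] mem[of "t + int a + int b"] unfolding prod.inject
    by cases (metis rot)+
qed

lemma card_3_imp_tri: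
  assumes "\<sigma> \<subseteq> {..<k}" "card \<sigma> = 3"
  obtains a b t where "0 < a" "0 < b" "a + b < k" "\<sigma> = tri k a b t"
proof -
  have "\<exists>x y z. x < y \<and> y < z \<and> \<sigma> = {x, y, z}"
  proof -
    obtain p q r where pqr: "\<sigma> = {p, q, r}" "p \<noteq> q" "q \<noteq> r" "p \<noteq> r"
      using assms(2) by (auto simp: card_3_iff)
    have *: "\<sigma> = {p, r, q}" "\<sigma> = {q, p, r}" "\<sigma> = {q, r, p}" "\<sigma> = {r, p, q}" "\<sigma> = {r, q, p}"
      using pqr(1) by auto
    have "p < q \<and> q < r \<or> p < r \<and> r < q \<or> q < p \<and> p < r \<or> q < r \<and> r < p \<or>
        r < p \<and> p < q \<or> r < q \<and> q < p"
      using pqr(2-4) by linarith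
    then show ?thesis using * pqr(1) by blast
  qed
  then obtain x y z where xyz: "x < y" "y < z" "\<sigma> = {x, y, z}" by blast
  then have "z < k" using assms by auto
  show ?thesis
  proof (rule that[of "y - x" "z - y" "int x"])
    have "int x + int (y - x) = int y" "int x + int (y - x) + int (z - y) = int z"
      using xyz by auto
    then show "\<sigma> = tri k (y - x) (z - y) (int x)"
      using xyz \<open>z < k\<close> by (simp add: tri_def del: of_nat_diff)
  qed (use xyz \<open>z < k\<close> in auto)
qed

text \<open>Off the diagonal, \<open>l + 2 * j < k\<close> says that the omitted gap exceeds
  \<open>j\<close>, so the triple is sorted. On the diagonal the omitted gap only has to be positive
  and may be smaller than \<open>l\<close>.\<close>

definition ms_index :: "nat \<Rightarrow> (nat \<times> nat) set" where
  "ms_index k = {(l, j). 0 < l \<and> (l = j \<and> 2 * l < k \<or> l < j \<and> l + 2 * j < k)}"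

lemma M_S_family_eq:
  assumes "k > 0"
  shows "M_family k = (\<lambda>l. cyc k l l) ` {1..(k - 1) div 2}"
    and "S_family k = (\<lambda>(l, j). cyc k l j) ` {(l, j). 0 < l \<and> l < j \<and> l + 2 * j < k}"
    and "M_family k \<union> S_family k = (\<lambda>(l, j). cyc k l j) ` ms_index k"
proof -
  have *: "1 \<le> l \<and> l \<le> (k - 1) div 2 \<longleftrightarrow> 0 < l \<and> 2 * l < k" for l
    using assms by (auto simp: less_eq_div_iff_mult_less_eq)
  have "M_complex l k = cyc k l l" if "l \<in> {1..(k - 1) div 2}" for l
    using that *[of l] M_complex_eq_cyc by simp
  then have "(\<lambda>l. M_complex l k) ` {1..(k - 1) div 2} = (\<lambda>l. cyc k l l) ` {1..(k - 1) div 2}"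
    by (rule image_cong[OF refl])
  then show M: "M_family k = (\<lambda>l. cyc k l l) ` {1..(k - 1) div 2}"
    unfolding M_family_def by (simp add: setcompr_eq_image atLeastAtMost_def atLeast_def atMost_def Int_def)
  have **: "1 \<le> l \<and> l < j \<and> j < k - l - j \<longleftrightarrow> 0 < l \<and> l < j \<and> l + 2 * j < k" for l j by auto
  let ?I = "{(l, j). 0 < l \<and> l < j \<and> l + 2 * j < k}"
  have "S_family k = (\<lambda>(l, j). S_complex l j k) ` ?I"
    unfolding S_family_def ** by (auto simp: image_iff)
  also have "\<dots> = (\<lambda>(l, j). cyc k l j) ` ?I"
    by (rule image_cong[OF refl]) (auto simp: S_complex_eq_cyc)
  finally show S: "S_family k = (\<lambda>(l, j). cyc k l j) ` ?I" .
  have "{1..(k - 1) div 2} = {l. 0 < l \<and> 2 * l < k}"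
    by (rule set_eqI) (simp only: * atLeastAtMost_iff mem_Collect_eq)
  moreover have "ms_index k = (\<lambda>l. (l, l)) ` {l. 0 < l \<and> 2 * l < k} \<union> ?I"
    by (auto simp: ms_index_def)
  ultimately show "M_family k \<union> S_family k = (\<lambda>(l, j). cyc k l j) ` ms_index k"
    unfolding M S by (simp add: image_Un image_image)
qed

text \<open>The index is a function of the unordered gaps: the repeated gap when
  \<open>l = j\<close>, otherwise the minimum and the median. The median is written as the sum minus
  minimum and maximum.\<close>

lemma ms_index_unique:
  assumes "\<not> 3 dvd k" "0 < a" "0 < b" "a + b < k"
    and "(l, j) \<in> ms_index k" "tri k a b t \<in> cyc k l j"
    and "(l', j') \<in> ms_index k" "tri k a b t \<in> cyc k l' j'"
  shows "l = l' \<and> j = j'"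
proof -
  define c where "c = k - a - b"
  have c: "k = a + b + c" "c > 0" using assms by (auto simp: c_def)
  have R: "l = a \<and> j = b \<or> l = b \<and> j = c \<or> l = c \<and> j = a \<or>
      l = b \<and> j = a \<or> l = c \<and> j = b \<or> l = a \<and> j = c"
    "l = j \<and> 2 * l < k \<or> l < j \<and> l + 2 * j < k"
    if "(l, j) \<in> ms_index k" "tri k a b t \<in> cyc k l j" for l j
  proof -
    show *: "l = j \<and> 2 * l < k \<or> l < j \<and> l + 2 * j < k"
      using that(1) by (auto simp: ms_index_def)
    have "0 < l" using that(1) by (simp add: ms_index_def)
    with * that(2) show "l = a \<and> j = b \<or> l = b \<and> j = c \<or> l = c \<and> j = a \<or>
        l = b \<and> j = a \<or> l = c \<and> j = b \<or> l = a \<and> j = c"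
      using tri_mem_cyc_iff[OF assms(2-4), of l j t] unfolding c_def[symmetric] bex_simps prod.inject
      by (elim disjE; simp; blast)
  qed
  let ?mn = "min a (min b c)" and ?mx = "max a (max b c)"
  have eq: "a = b \<and> l = a \<or> b = c \<and> l = b \<or> c = a \<and> l = c"
    if "(l, j) \<in> ms_index k" "tri k a b t \<in> cyc k l j" "l = j" for l j
    using R(1)[OF that(1,2)] that(3) by (elim disjE conjE; simp)
  have less: "a \<noteq> b \<and> b \<noteq> c \<and> c \<noteq> a \<and> l = ?mn \<and> j = a + b + c - ?mn - ?mx"
    if "(l, j) \<in> ms_index k" "tri k a b t \<in> cyc k l j" "l \<noteq> j" for l j
  proof -
    have "l < j \<and> l + 2 * j < a + b + c" using R(2)[OF that(1,2)] that(3) c by auto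
    then show ?thesis using R(1)[OF that(1,2)] by (elim disjE conjE; simp)
  qed
  \<comment> \<open>Two different pairs of equal gaps would make all three equal, and then
    \<open>3 dvd k\<close>.\<close>
  have ne: "a \<noteq> b \<or> b \<noteq> c" using assms(1) c by presburger
  show ?thesis
  proof (cases "l = j")
    case True
    note * = eq[OF assms(5,6) True]
    then have "l' = j'" using less[OF assms(7,8)] by blast
    with * eq[OF assms(7,8)] ne True show ?thesis by (elim disjE conjE; simp)
  next
    case False
    note * = less[OF assms(5,6) False]
    then have "l' \<noteq> j'" using eq[OF assms(7,8)] by blast
    with * less[OF assms(7,8)] show ?thesis by simp
  qed
qed

text \<open>Any two of the three gaps are cyclically adjacent in one of the two orders. So the two
  equal gaps, or else the two smallest, can serve as the index pair.\<close>

lemma ms_index_exists: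
  assumes "\<not> 3 dvd k" "0 < a" "0 < b" "a + b < k"
  obtains l j where "(l, j) \<in> ms_index k" "tri k a b t \<in> cyc k l j"
proof -
  define c where "c = k - a - b"
  have c: "k = a + b + c" "c > 0" using assms by (auto simp: c_def)

  have "\<exists>l j. (l, j) \<in> ms_index k \<and> (\<exists>p\<in>{(a, b), (b, c), (c, a)}. p = (l, j) \<or> p = (j, l))"
  proof -
    have P: "?thesis" if "(l, j) \<in> ms_index k" "p \<in> {(a, b), (b, c), (c, a)}" "p = (l, j) \<or> p = (j, l)"
      for l j p using that by blast
    consider "a = b" | "b = c" | "c = a" | "a < b" "b < c" | "a < c" "c < b" | "b < a" "a < c"
      | "b < c" "c < a" | "c < a" "a < b" | "c < b" "b < a" by linarith
    then show ?thesis
    proof cases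
      case 1 with c assms(2,3) show ?thesis by (intro P[of a b "(a, b)"]) (auto simp: ms_index_def)
    next
      case 2 with c assms(2,3) show ?thesis by (intro P[of b c "(b, c)"]) (auto simp: ms_index_def)
    next
      case 3 with c assms(2,3) show ?thesis by (intro P[of c a "(c, a)"]) (auto simp: ms_index_def)
    next
      case 4 with c assms(2,3) show ?thesis by (intro P[of a b "(a, b)"]) (auto simp: ms_index_def)
    next
      case 5 with c assms(2,3) show ?thesis by (intro P[of a c "(c, a)"]) (auto simp: ms_index_def)
    next
      case 6 with c assms(2,3) show ?thesis by (intro P[of b a "(a, b)"]) (auto simp: ms_index_def)
    next
      case 7 with c assms(2,3) show ?thesis by (intro P[of b c "(b, c)"]) (auto simp: ms_index_def)
    next
      case 8 with c assms(2,3) show ?thesis by (intro P[of c a "(c, a)"]) (auto simp: ms_index_def)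
    next
      case 9 with c assms(2,3) show ?thesis by (intro P[of c b "(b, c)"]) (auto simp: ms_index_def)
    qed
  qed
  then obtain l j where lj: "(l, j) \<in> ms_index k"
    "\<exists>p\<in>{(a, b), (b, c), (c, a)}. p = (l, j) \<or> p = (j, l)" by blast
  moreover have "0 < l" "0 < j" "l + j < k" using lj(1) by (auto simp: ms_index_def)
  ultimately have "tri k a b t \<in> cyc k l j"
    using tri_mem_cyc_iff[OF assms(2-4), of l j t] unfolding c_def by blast
  with lj(1) show ?thesis by (rule that)
qed

text \<open>The triangle \<open>tri k l j 0\<close> alone determines the index pair, so counting
  complexes becomes counting pairs.\<close>

lemma inj_on_cyc:
  assumes "\<not> 3 dvd k"
  shows "inj_on (\<lambda>(l, j). cyc k l j) (ms_index k)"
proof (rule inj_onI, clarify)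
  fix l j l' j' assume A: "(l, j) \<in> ms_index k" "(l', j') \<in> ms_index k" "cyc k l j = cyc k l' j'"
  have "tri k l j 0 \<in> cyc k l j" by (auto simp: mem_cyc tri_def)
  moreover have "0 < l" "0 < j" "l + j < k" using A(1) by (auto simp: ms_index_def)
  ultimately show "l = l' \<and> j = j'"
    using ms_index_unique[OF assms, of l j l j 0 l' j'] A by simp
qed

lemma triangles_skel_full_simplex:
  "triangles (skel 2 (full_simplex k)) = {\<sigma>. \<sigma> \<subseteq> {..<k} \<and> card \<sigma> = 3}"
  by (auto simp: triangles_def skel_def full_simplex_def generated_complex_def
      lessThan_atLeast0)

lemma decomposes_M_S:
  assumes "k > 0" "\<not> 3 dvd k"
  shows "decomposes (skel 2 (full_simplex k)) (M_family k \<union> S_family k)"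
  unfolding decomposes_def triangles_skel_full_simplex M_S_family_eq(3)[OF assms(1)]
proof (intro conjI ballI)
  fix L assume "L \<in> (\<lambda>(l, j). cyc k l j) ` ms_index k"
  then obtain l j where "L = cyc k l j" by auto
  moreover have "\<sigma> \<in> skel 2 (full_simplex k)" if "\<sigma> \<in> cyc k l j" for \<sigma>
  proof -
    have "\<sigma> \<noteq> {}" using that by (auto simp: mem_cyc)
    moreover have "\<sigma> \<subseteq> {0..<k}" using cyc_subset[OF assms(1) that] by auto
    ultimately show ?thesis using card_cyc[OF that]
      by (simp add: skel_def full_simplex_def generated_complex_def)
  qed
  ultimately show "L \<subseteq> skel 2 (full_simplex k)" by blast
next
  fix \<sigma> assume "\<sigma> \<in> {\<sigma>. \<sigma> \<subseteq> {..<k} \<and> card \<sigma> = 3}"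
  then obtain a b t where abt: "0 < a" "0 < b" "a + b < k" "\<sigma> = tri k a b t"
    using card_3_imp_tri[of \<sigma> k] by auto
  obtain l j where lj: "(l, j) \<in> ms_index k" "\<sigma> \<in> cyc k l j"
    using ms_index_exists[OF assms(2) abt(1-3), of t] abt(4) by blast
  show "\<exists>!L. L \<in> (\<lambda>(l, j). cyc k l j) ` ms_index k \<and> \<sigma> \<in> L"
  proof (rule ex1I[of _ "cyc k l j"])
    show "cyc k l j \<in> (\<lambda>(l, j). cyc k l j) ` ms_index k \<and> \<sigma> \<in> cyc k l j"
      using lj by force
  next
    fix L assume "L \<in> (\<lambda>(l, j). cyc k l j) ` ms_index k \<and> \<sigma> \<in> L"
    then obtain l' j' where "(l', j') \<in> ms_index k" "L = cyc k l' j'" "\<sigma> \<in> L" by auto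
    then show "L = cyc k l j"
      using ms_index_unique[OF assms(2) abt(1-3) lj(1), of t l' j'] lj(2) abt(4) by simp
  qed
qed

section \<open>Counting the two families\<close>

lemma card_M_family:
  assumes "k > 0" "\<not> 3 dvd k"
  shows "card (M_family k) = (k - 1) div 2"
proof -
  have "inj_on ((\<lambda>(l, j). cyc k l j) \<circ> (\<lambda>l. (l, l))) {1..(k - 1) div 2}"
  proof (rule comp_inj_on)
    show "inj_on (\<lambda>(l, j). cyc k l j) ((\<lambda>l. (l, l)) ` {1..(k - 1) div 2})"
      by (rule inj_on_subset[OF inj_on_cyc[OF assms(2)]]) (auto simp: ms_index_def)
  qed (auto simp: inj_on_def)
  from card_image[OF this] show ?thesis by (simp add: M_S_family_eq[OF assms(1)] comp_def)
qed

definition scalene :: "nat \<Rightarrow> (nat \<times> nat) set" where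
  "scalene k = {(l, j). 0 < l \<and> l < j \<and> l + 2 * j < k}"

text \<open>Subtracting 2 from all three gaps leaves the triples with least gap 1 or 2 to be counted.\<close>

lemma card_scalene_step: "card (scalene (2 * h + 1 + 6)) = card (scalene (2 * h + 1)) + (2 * h + 1)"
proof -
  let ?f = "\<lambda>(l, j). (l + 2, j + 2) :: nat \<times> nat"
  \<comment> \<open>The bound on \<open>j\<close> is \<open>h + 2\<close> for both small values of
    \<open>l\<close>: \<open>l = 1\<close> contributes \<open>h + 1\<close> pairs and
    \<open>l = 2\<close> contributes \<open>h\<close>, together the increment
    \<open>2 * h + 1\<close>.\<close>
  have eq: "scalene (2 * h + 1 + 6) =
     ?f ` scalene (2 * h + 1) \<union> ((\<lambda>j. (1, j)) ` {2..h + 2} \<union> (\<lambda>j. (2, j)) ` {3..h + 2})"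
  proof (intro subset_antisym subsetI)
    fix p assume "p \<in> scalene (2 * h + 1 + 6)"
    then obtain l j where p: "p = (l, j)" "0 < l" "l < j" "l + 2 * j < 2 * h + 7"
      by (auto simp: scalene_def)
    consider "l = 1" | "l = 2" | "l > 2" using p by linarith
    then show "p \<in> ?f ` scalene (2 * h + 1) \<union> ((\<lambda>j. (1, j)) ` {2..h + 2} \<union> (\<lambda>j. (2, j)) ` {3..h + 2})"
    proof cases
      case 3
      then have "p = ?f (l - 2, j - 2)" "(l - 2, j - 2) \<in> scalene (2 * h + 1)"
        using p by (auto simp: scalene_def)
      then show ?thesis by blast
    qed (use p in auto)
  qed (auto simp: scalene_def)
  have "scalene n \<subseteq> {..<n} \<times> {..<n}" for n by (auto simp: scalene_def)
  then have fin: "finite (scalene n)" for n by (rule finite_subset) simp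
  have "card (scalene (2 * h + 1 + 6)) = card (?f ` scalene (2 * h + 1)) +
      card ((\<lambda>j. (1::nat, j)) ` {2..h + 2} \<union> (\<lambda>j. (2, j)) ` {3..h + 2})"
    unfolding eq by (rule card_Un_disjoint[OF finite_imageI[OF fin]]) (auto simp: scalene_def)
  also have "card ((\<lambda>j. (1::nat, j)) ` {2..h + 2} \<union> (\<lambda>j. (2, j)) ` {3..h + 2})
      = card ((\<lambda>j. (1::nat, j)) ` {2..h + 2}) + card ((\<lambda>j. (2::nat, j)) ` {3..h + 2})"
    by (rule card_Un_disjoint) auto
  also have "card ((\<lambda>j. (1::nat, j)) ` {2..h + 2}) = h + 1" by (subst card_image) (auto simp: inj_on_def)
  also have "card ((\<lambda>j. (2::nat, j)) ` {3..h + 2}) = h" by (subst card_image) (auto simp: inj_on_def)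
  also have "card (?f ` scalene (2 * h + 1)) = card (scalene (2 * h + 1))"
    by (subst card_image) (auto simp: inj_on_def)
  finally show ?thesis by simp
qed

text \<open>Passing from \<open>n\<close> to \<open>n + 6\<close> raises \<open>n^2 - 6n + 5\<close>
  by \<open>12 * n\<close>, matching the \<open>n\<close> new pairs; the polynomial vanishes at 1
  and 5, where no pair exists.\<close>

lemma card_scalene:
  assumes "r = 1 \<or> r = 5"
  shows "12 * int (card (scalene (6 * q + r))) = (int (6 * q + r))\<^sup>2 - 6 * int (6 * q + r) + 5"
proof (induction q)
  case 0
  have "scalene r = {}" using assms by (auto simp: scalene_def)
  then show ?case using assms by auto
next
  case (Suc q)
  have "odd (6 * q + r)" using assms by auto
  then obtain h where h: "6 * q + r = 2 * h + 1" by (rule oddE)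
  have "6 * Suc q + r = 2 * h + 1 + 6" using h by simp
  then have "card (scalene (6 * Suc q + r)) = card (scalene (6 * q + r)) + (6 * q + r)"
    using card_scalene_step[of h] h by metis
  moreover have "int (6 * Suc q + r) = int (6 * q + r) + 6" by simp
  ultimately show ?case using Suc.IH
    by (simp only: of_nat_add) (simp add: power2_eq_square algebra_simps)
qed

lemma card_S_family:
  assumes "k mod 6 = 1 \<or> k mod 6 = 5"
  shows "12 * int (card (S_family k)) = (int k)\<^sup>2 - 6 * int k + 5"
proof -
  have k: "k > 0" "\<not> 3 dvd k" using assms by (auto, presburger+)
  have "inj_on (\<lambda>(l, j). cyc k l j) (scalene k)"
    by (rule inj_on_subset[OF inj_on_cyc[OF k(2)]]) (auto simp: ms_index_def scalene_def)
  then have "card (S_family k) = card (scalene k)"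
    by (simp add: M_S_family_eq[OF k(1)] scalene_def card_image)
  then show ?thesis using card_scalene[OF assms, of "k div 6"] by simp
qed

section \<open>Barycentric coordinates from the triangulated plane\<close>

definition real_points :: "nat set set \<Rightarrow> (nat \<Rightarrow> real) set" where
  "real_points K = {x. (\<forall>v. 0 \<le> x v) \<and> {v. x v \<noteq> 0} \<in> K \<and> (\<Sum>v | x v \<noteq> 0. x v) = 1}"

lemma realization_eq: "realization K = top_of_set (real_points K)"
  unfolding realization_def real_points_def euclidean_product_topology ..

lemma real_points_pos:
  assumes "x \<in> real_points K"
  obtains v where "x v > 0"
proof -
  have "\<exists>v. x v \<noteq> 0"
  proof (rule ccontr)
    assume "\<not> (\<exists>v. x v \<noteq> 0)"
    then show False using assms by (simp add: real_points_def)
  qed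
  then show ?thesis using assms that by (force simp: real_points_def less_le)
qed

text \<open>Weights add up if vertices coincide, so points can be written down before the labels are
  known to be distinct.\<close>

definition pt3 :: "nat \<Rightarrow> real \<Rightarrow> nat \<Rightarrow> real \<Rightarrow> nat \<Rightarrow> real \<Rightarrow> nat \<Rightarrow> real" where
  "pt3 u \<alpha> v \<beta> w \<gamma> y = \<alpha> * of_bool (y = u) + \<beta> * of_bool (y = v) + \<gamma> * of_bool (y = w)"

lemma pt3_in_real_points:
  assumes "abstract_complex K" "\<sigma> \<in> K" "u \<in> \<sigma>" "v \<in> \<sigma>" "w \<in> \<sigma>"
    and "0 \<le> \<alpha>" "0 \<le> \<beta>" "0 \<le> \<gamma>" "\<alpha> + \<beta> + \<gamma> = 1"
  shows "pt3 u \<alpha> v \<beta> w \<gamma> \<in> real_points K"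
proof -
  let ?x = "pt3 u \<alpha> v \<beta> w \<gamma>"
  have fin: "finite \<sigma>" using assms(1,2) by (simp add: abstract_complex_def)
  have supp: "{y. ?x y \<noteq> 0} \<subseteq> \<sigma>" using assms(3-5) by (auto simp: pt3_def)
  have "(\<Sum>y\<in>\<sigma>. ?x y) = 1"
    using assms(3-5,9) fin
    by (simp add: pt3_def sum.distrib sum_distrib_left[symmetric] of_bool_def)
  then have sum: "(\<Sum>y | ?x y \<noteq> 0. ?x y) = 1"
    using sum.mono_neutral_left[OF fin supp, of ?x] by auto
  then have "{y. ?x y \<noteq> 0} \<noteq> {}" by (metis sum.empty zero_neq_one)
  then have "{y. ?x y \<noteq> 0} \<in> K" using supp assms(1,2) unfolding abstract_complex_def by blast
  then show ?thesis using sum assms(6-8) by (simp add: real_points_def pt3_def)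
qed

lemma real_points_eq_pt3:
  assumes "x \<in> real_points K" "{y. x y \<noteq> 0} \<subseteq> {u, v, w}" "distinct [u, v, w]"
  shows "x = pt3 u (x u) v (x v) w (x w)" "x u + x v + x w = 1"
proof -
  have z: "x y = 0" if "y \<noteq> u" "y \<noteq> v" "y \<noteq> w" for y using assms(2) that by auto
  show "x = pt3 u (x u) v (x v) w (x w)"
  proof
    fix y
    consider "y = u" | "y = v" | "y = w" | "y \<noteq> u" "y \<noteq> v" "y \<noteq> w" by blast
    then show "x y = pt3 u (x u) v (x v) w (x w) y"
      by cases (use assms(3) in \<open>auto simp: pt3_def z\<close>)
  qed
  have "(\<Sum>y\<in>{u, v, w}. x y) = (\<Sum>y | x y \<noteq> 0. x y)"
    using assms(2) by (intro sum.mono_neutral_right) auto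
  then show "x u + x v + x w = 1" using assms(1,3) by (simp add: real_points_def)
qed

definition lat :: "nat \<Rightarrow> nat \<Rightarrow> nat \<Rightarrow> int \<Rightarrow> int \<Rightarrow> int \<Rightarrow> nat" where
  "lat k l j c a b = vx k (c + a * int l + b * int j)"

text \<open>The four terms are the corners of the unit square around \<open>(s, t)\<close>, which the diagonal of
  direction \<open>(1, 1)\<close> cuts into two triangles.\<close>

definition bary :: "nat \<Rightarrow> nat \<Rightarrow> nat \<Rightarrow> int \<Rightarrow> real \<Rightarrow> real \<Rightarrow> nat \<Rightarrow> real" where
  "bary k l j c s t v = (let a = \<lfloor>s\<rfloor>; b = \<lfloor>t\<rfloor>; f = frac s; g = frac t in
     (1 - max f g) * of_bool (v = lat k l j c a b) +
     max 0 (f - g) * of_bool (v = lat k l j c (a + 1) b) +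
     max 0 (g - f) * of_bool (v = lat k l j c a (b + 1)) +
     min f g * of_bool (v = lat k l j c (a + 1) (b + 1)))"

definition hexagon :: "(real \<times> real) set" where
  "hexagon = {(s, t). \<bar>s\<bar> < 1 \<and> \<bar>t\<bar> < 1 \<and> \<bar>s - t\<bar> < 1}"

lemma lat_lat: "lat k l j (c + a * int l + b * int j) a' b' = lat k l j c (a' + a) (b' + b)"
  by (simp add: lat_def algebra_simps)

text \<open>A lattice translation only changes the base label, so every local question can be moved
  to the origin.\<close>

lemma bary_translate:
  "bary k l j c (s + of_int a) (t + of_int b) = bary k l j (c + a * int l + b * int j) s t"
proof
  fix v
  have "\<lfloor>s + of_int a\<rfloor> = \<lfloor>s\<rfloor> + a" "frac (s + of_int a) = frac s"
    "\<lfloor>t + of_int b\<rfloor> = \<lfloor>t\<rfloor> + b" "frac (t + of_int b) = frac t"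
    by (simp_all add: frac_def)
  moreover have "\<lfloor>s\<rfloor> + a + 1 = \<lfloor>s\<rfloor> + 1 + a" "\<lfloor>t\<rfloor> + b + 1 = \<lfloor>t\<rfloor> + 1 + b" by simp_all
  ultimately show "bary k l j c (s + of_int a) (t + of_int b) v =
      bary k l j (c + a * int l + b * int j) s t v"
    unfolding bary_def Let_def lat_lat by (simp only:)
qed

lemma bary_cong:
  assumes "k > 0" "int k dvd c - d"
  shows "bary k l j c = bary k l j d"
proof -
  have "lat k l j c a b = lat k l j d a b" for a b
    using assms by (simp add: lat_def vx_eq_iff)
  then show ?thesis by (intro ext) (simp add: bary_def)
qed

text \<open>This is the fold: for \<open>j = l\<close>, reflection in the diagonal preserves all
  labels.\<close>

lemma bary_swap: "bary k l l c s t = bary k l l c t s"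
proof
  fix v
  have L: "lat k l l c a b = lat k l l c b a" for a b
    by (simp add: lat_def add.assoc add.commute[of "a * int l"])
  note [simp] = L[of "\<lfloor>t\<rfloor>" "\<lfloor>s\<rfloor>"] L[of "\<lfloor>t\<rfloor> + 1" "\<lfloor>s\<rfloor>"] L[of "\<lfloor>t\<rfloor>" "\<lfloor>s\<rfloor> + 1"] L[of "\<lfloor>t\<rfloor> + 1" "\<lfloor>s\<rfloor> + 1"]
    max.commute[of "frac t" "frac s"] min.commute[of "frac t" "frac s"]
  show "bary k l l c s t v = bary k l l c t s v" by (simp add: bary_def Let_def)
qed

lemma bary_cases:
  obtains "frac t \<le> frac s"
      "bary k l j c s t = pt3 (lat k l j c \<lfloor>s\<rfloor> \<lfloor>t\<rfloor>) (1 - frac s)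
         (lat k l j c (\<lfloor>s\<rfloor> + 1) \<lfloor>t\<rfloor>) (frac s - frac t) (lat k l j c (\<lfloor>s\<rfloor> + 1) (\<lfloor>t\<rfloor> + 1)) (frac t)"
  | "frac s \<le> frac t"
      "bary k l j c s t = pt3 (lat k l j c \<lfloor>s\<rfloor> \<lfloor>t\<rfloor>) (1 - frac t)
         (lat k l j c \<lfloor>s\<rfloor> (\<lfloor>t\<rfloor> + 1)) (frac t - frac s) (lat k l j c (\<lfloor>s\<rfloor> + 1) (\<lfloor>t\<rfloor> + 1)) (frac s)"
proof (cases "frac t \<le> frac s")
  case True
  then show ?thesis by (intro that(1) ext) (simp_all add: bary_def pt3_def max_def min_def Let_def)
next
  case False
  then show ?thesis by (intro that(2) ext) (simp_all add: bary_def pt3_def max_def min_def Let_def)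
qed

text \<open>The half \<open>frac t \<le> frac s\<close> of a cell goes to a translate of
  \<open>tri k l j\<close>, the other half to a translate of \<open>tri k j l\<close>.\<close>

lemma bary_in_cyc_comp:
  assumes "k > 0"
  shows "bary k l j c s t \<in> real_points (cyc_comp k l j c)"
proof -
  let ?a = "\<lfloor>s\<rfloor>" and ?b = "\<lfloor>t\<rfloor>"
  have ac: "abstract_complex (cyc_comp k l j c)"
    using abstract_complex_cyc[OF assms, of l j]
    by (auto simp: abstract_complex_def cyc_comp_def)
  let ?z = "c + ?a * int l + ?b * int j"
  have V: "lat k l j c ?a ?b = vx k ?z" "lat k l j c (?a + 1) ?b = vx k (?z + int l)"
     "lat k l j c ?a (?b + 1) = vx k (?z + int j)"
     "lat k l j c (?a + 1) (?b + 1) = vx k (?z + int l + int j)"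
     "lat k l j c (?a + 1) (?b + 1) = vx k (?z + int j + int l)"
    by (simp_all add: lat_def algebra_simps)
  have R: "lat k l j c a b \<in> res_class k (gcd l (gcd j k)) c" for a b
    unfolding lat_def by (rule lattice_res_class[OF assms])
  have "tri k l j ?z \<subseteq> res_class k (gcd l (gcd j k)) c" "tri k j l ?z \<subseteq> res_class k (gcd l (gcd j k)) c"
    unfolding tri_def V[symmetric] using R by auto
  moreover have "tri k l j ?z \<in> cyc k l j" "tri k j l ?z \<in> cyc k l j"
    by (auto simp: mem_cyc tri_def)
  ultimately have T: "tri k l j ?z \<in> cyc_comp k l j c" "tri k j l ?z \<in> cyc_comp k l j c"
    by (simp_all add: cyc_comp_def)
  have f: "0 \<le> frac s" "frac s \<le> 1" "0 \<le> frac t" "frac t \<le> 1"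
    by (simp_all add: frac_ge_0 frac_lt_1 less_imp_le)
  show ?thesis
  proof (cases rule: bary_cases[of t s k l j c])
    case 1
    show ?thesis unfolding 1(2)
      by (rule pt3_in_real_points[OF ac T(1)]) (use 1(1) f in \<open>auto simp: tri_def V(1,2,4)\<close>)
  next
    case 2
    show ?thesis unfolding 2(2)
      by (rule pt3_in_real_points[OF ac T(2)]) (use 2(1) f in \<open>auto simp: tri_def V(1,3,5)\<close>)
  qed
qed

lemma real_points_cyc_comp:
  "real_points (cyc_comp k l j c) =
     {x \<in> real_points (cyc k l j). {v. x v \<noteq> 0} \<subseteq> res_class k (gcd l (gcd j k)) c}"
  by (auto simp: real_points_def cyc_comp_def)

lemma bary_in_cyc: "k > 0 \<Longrightarrow> bary k l j c s t \<in> real_points (cyc k l j)"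
  using bary_in_cyc_comp real_points_cyc_comp by blast

text \<open>The hat functions of the six neighbours of the origin all have this shape.\<close>

definition pmin :: "real \<Rightarrow> real \<Rightarrow> real" where
  "pmin a b = max 0 (min a b)"

text \<open>Replaces floors and fractional parts by one piecewise linear formula that is valid
  across the cell borders. The weight of the centre is 1 minus the norm whose unit ball is the
  hexagon.\<close>

lemma bary_hexagon:
  assumes "(s, t) \<in> hexagon"
  shows "bary k l j c s t v =
    (1 - max \<bar>s\<bar> (max \<bar>t\<bar> \<bar>s - t\<bar>)) * of_bool (v = lat k l j c 0 0) +
    pmin s (s - t) * of_bool (v = lat k l j c 1 0) +
    pmin t (t - s) * of_bool (v = lat k l j c 0 1) +
    pmin s t * of_bool (v = lat k l j c 1 1) +
    pmin (- s) (t - s) * of_bool (v = lat k l j c (- 1) 0) +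
    pmin (- t) (s - t) * of_bool (v = lat k l j c 0 (- 1)) +
    pmin (- s) (- t) * of_bool (v = lat k l j c (- 1) (- 1))"
proof -
  have st: "\<bar>s\<bar> < 1" "\<bar>t\<bar> < 1" "\<bar>s - t\<bar> < 1" using assms by (auto simp: hexagon_def)
  have s0: "\<lfloor>s\<rfloor> = 0" "frac s = s" if "0 \<le> s" using st that by (auto simp: floor_eq_iff frac_def)
  have s1: "\<lfloor>s\<rfloor> = - 1" "frac s = s + 1" if "s < 0"
  proof -
    show "\<lfloor>s\<rfloor> = - 1" using st that by linarith
    then show "frac s = s + 1" by (simp add: frac_def)
  qed
  have t0: "\<lfloor>t\<rfloor> = 0" "frac t = t" if "0 \<le> t" using st that by (auto simp: floor_eq_iff frac_def)
  have t1: "\<lfloor>t\<rfloor> = - 1" "frac t = t + 1" if "t < 0"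
  proof -
    show "\<lfloor>t\<rfloor> = - 1" using st that by linarith
    then show "frac t = t + 1" by (simp add: frac_def)
  qed
  consider "0 \<le> s" "0 \<le> t" "t \<le> s" | "0 \<le> s" "0 \<le> t" "s < t" | "s < 0" "t < 0" "t \<le> s"
    | "s < 0" "t < 0" "s < t" | "0 \<le> s" "t < 0" | "s < 0" "0 \<le> t" by linarith
  then show ?thesis
  proof cases
    case 1 with st show ?thesis by (simp add: bary_def s0 t0 pmin_def max_def min_def)
  next
    case 2 with st show ?thesis by (simp add: bary_def s0 t0 pmin_def max_def min_def)
  next
    case 3 with st show ?thesis by (simp add: bary_def s1 t1 pmin_def max_def min_def)
  next
    case 4 with st show ?thesis by (simp add: bary_def s1 t1 pmin_def max_def min_def)
  next
    case 5 with st show ?thesis by (simp add: bary_def s0 t1 pmin_def max_def min_def)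
  next
    case 6 with st show ?thesis by (simp add: bary_def s1 t0 pmin_def max_def min_def)
  qed
qed

text \<open>The six triangles around the origin, each parametrised by its barycentric weights;
  \<open>\<alpha> > 0\<close> keeps the point in the open star. These formulas verify the inverse of
  the chart sector by sector.\<close>

lemma bary_sectors:
  assumes "\<alpha> > 0" "\<beta> \<ge> 0" "\<gamma> \<ge> 0" "\<alpha> + \<beta> + \<gamma> = 1"
  shows "(\<beta> + \<gamma>, \<gamma>) \<in> hexagon"
    "bary k l j c (\<beta> + \<gamma>) \<gamma> = pt3 (lat k l j c 0 0) \<alpha> (lat k l j c 1 0) \<beta> (lat k l j c 1 1) \<gamma>"
    "(\<gamma>, \<beta> + \<gamma>) \<in> hexagon"
    "bary k l j c \<gamma> (\<beta> + \<gamma>) = pt3 (lat k l j c 0 0) \<alpha> (lat k l j c 0 1) \<beta> (lat k l j c 1 1) \<gamma>"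
    "(- \<beta>, \<gamma>) \<in> hexagon"
    "bary k l j c (- \<beta>) \<gamma> = pt3 (lat k l j c 0 0) \<alpha> (lat k l j c (- 1) 0) \<beta> (lat k l j c 0 1) \<gamma>"
    "(\<gamma>, - \<beta>) \<in> hexagon"
    "bary k l j c \<gamma> (- \<beta>) = pt3 (lat k l j c 0 0) \<alpha> (lat k l j c 0 (- 1)) \<beta> (lat k l j c 1 0) \<gamma>"
    "(- \<beta>, - \<beta> - \<gamma>) \<in> hexagon"
    "bary k l j c (- \<beta>) (- \<beta> - \<gamma>) = pt3 (lat k l j c 0 0) \<alpha> (lat k l j c (- 1) (- 1)) \<beta> (lat k l j c 0 (- 1)) \<gamma>"
    "(- \<beta> - \<gamma>, - \<beta>) \<in> hexagon"
    "bary k l j c (- \<beta> - \<gamma>) (- \<beta>) = pt3 (lat k l j c 0 0) \<alpha> (lat k l j c (- 1) (- 1)) \<beta> (lat k l j c (- 1) 0) \<gamma>"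
proof -
  show hex: "(\<beta> + \<gamma>, \<gamma>) \<in> hexagon" "(\<gamma>, \<beta> + \<gamma>) \<in> hexagon" "(- \<beta>, \<gamma>) \<in> hexagon" "(\<gamma>, - \<beta>) \<in> hexagon"
    "(- \<beta>, - \<beta> - \<gamma>) \<in> hexagon" "(- \<beta> - \<gamma>, - \<beta>) \<in> hexagon"
    using assms by (auto simp: hexagon_def abs_if)
  have \<alpha>: "\<alpha> = 1 - \<beta> - \<gamma>" using assms by simp
  note bary_hexagon[OF hex(1)] bary_hexagon[OF hex(2)] bary_hexagon[OF hex(3)]
    bary_hexagon[OF hex(4)] bary_hexagon[OF hex(5)] bary_hexagon[OF hex(6)]
  note S = this pt3_def pmin_def max_def min_def abs_if \<alpha>
  show "bary k l j c (\<beta> + \<gamma>) \<gamma> = pt3 (lat k l j c 0 0) \<alpha> (lat k l j c 1 0) \<beta> (lat k l j c 1 1) \<gamma>"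
    "bary k l j c \<gamma> (\<beta> + \<gamma>) = pt3 (lat k l j c 0 0) \<alpha> (lat k l j c 0 1) \<beta> (lat k l j c 1 1) \<gamma>"
    "bary k l j c (- \<beta>) \<gamma> = pt3 (lat k l j c 0 0) \<alpha> (lat k l j c (- 1) 0) \<beta> (lat k l j c 0 1) \<gamma>"
    "bary k l j c \<gamma> (- \<beta>) = pt3 (lat k l j c 0 0) \<alpha> (lat k l j c 0 (- 1)) \<beta> (lat k l j c 1 0) \<gamma>"
    "bary k l j c (- \<beta>) (- \<beta> - \<gamma>) = pt3 (lat k l j c 0 0) \<alpha> (lat k l j c (- 1) (- 1)) \<beta> (lat k l j c 0 (- 1)) \<gamma>"
    "bary k l j c (- \<beta> - \<gamma>) (- \<beta>) = pt3 (lat k l j c 0 0) \<alpha> (lat k l j c (- 1) (- 1)) \<beta> (lat k l j c (- 1) 0) \<gamma>"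
    using assms(2,3) by (intro ext; simp add: S; fail)+
qed

text \<open>The side conditions say that the corner of the cell in question has positive weight: a
  point lies in the open star of each such corner.\<close>

lemma hexagon_cover:
  "(frac s, frac t) \<in> hexagon"
  "frac t < frac s \<Longrightarrow> (frac s - 1, frac t) \<in> hexagon"
  "frac s < frac t \<Longrightarrow> (frac s, frac t - 1) \<in> hexagon"
  "0 < frac s \<Longrightarrow> 0 < frac t \<Longrightarrow> (frac s - 1, frac t - 1) \<in> hexagon"
  using frac_ge_0[of s] frac_lt_1[of s] frac_ge_0[of t] frac_lt_1[of t]
  by (simp_all only: hexagon_def mem_Collect_eq prod.case abs_less_iff) (intro conjI TrueI; linarith)+

lemma pt3_pos:
  assumes "pt3 u \<alpha> v \<beta> w \<gamma> y > 0" "0 \<le> \<alpha>" "0 \<le> \<beta>" "0 \<le> \<gamma>"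
  shows "u = y \<or> v = y \<and> \<beta> > 0 \<or> w = y \<and> \<gamma> > 0"
  using assms by (auto simp: pt3_def of_bool_def split: if_splits)

lemma bary_pos_cases:
  assumes "bary k l j c s t v > 0"
  obtains "lat k l j c \<lfloor>s\<rfloor> \<lfloor>t\<rfloor> = v"
  | "lat k l j c (\<lfloor>s\<rfloor> + 1) \<lfloor>t\<rfloor> = v" "frac t < frac s"
  | "lat k l j c \<lfloor>s\<rfloor> (\<lfloor>t\<rfloor> + 1) = v" "frac s < frac t"
  | "lat k l j c (\<lfloor>s\<rfloor> + 1) (\<lfloor>t\<rfloor> + 1) = v" "0 < frac s" "0 < frac t"
proof (cases rule: bary_cases[of t s k l j c])
  case 1
  have "0 \<le> frac t" "frac s < 1" by (simp_all add: frac_lt_1)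
  then show ?thesis using pt3_pos[OF assms[unfolded 1(2)]] 1(1) that by fastforce
next
  case 2
  have "0 \<le> frac s" "frac t < 1" by (simp_all add: frac_lt_1)
  then show ?thesis using pt3_pos[OF assms[unfolded 2(2)]] 2(1) that by fastforce
qed

text \<open>A vertex of positive weight in the image lifts to a lattice point whose star contains
  the given point; this is how two preimages are later compared.\<close>

lemma bary_pos_hexagon:
  assumes "bary k l j c s t v > 0"
  obtains a b where "lat k l j c a b = v" "(s - of_int a, t - of_int b) \<in> hexagon"
proof (cases rule: bary_pos_cases[OF assms])
  case 1 then show ?thesis using hexagon_cover(1)[of s t] that by (simp add: frac_def)
next
  case 2 then show ?thesis using hexagon_cover(2)[of t s] that[of "\<lfloor>s\<rfloor> + 1" "\<lfloor>t\<rfloor>"] by (simp add: frac_def algebra_simps)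
next
  case 3 then show ?thesis using hexagon_cover(3)[of s t] that[of "\<lfloor>s\<rfloor>" "\<lfloor>t\<rfloor> + 1"] by (simp add: frac_def algebra_simps)
next
  case 4 then show ?thesis using hexagon_cover(4)[of s t] that[of "\<lfloor>s\<rfloor> + 1" "\<lfloor>t\<rfloor> + 1"] by (simp add: frac_def algebra_simps)
qed

lemma open_hexagon: "open hexagon"
  unfolding hexagon_def case_prod_beta
  by (intro open_Collect_conj open_Collect_less continuous_intros)

text \<open>The floors in \<open>bary\<close> hide continuity. The hexagon formula is visibly
  continuous, and each point lies in the open hexagon about the lower left corner of its
  cell.\<close>

lemma continuous_on_bary: "continuous_on S (\<lambda>p. bary k l j c (fst p) (snd p))"
proof -
  have hex: "continuous_on hexagon (\<lambda>p. bary k l j c (fst p) (snd p) v)" for c v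
  proof (rule continuous_on_eq)
    show "continuous_on hexagon (\<lambda>p. 
      (1 - max \<bar>fst p\<bar> (max \<bar>snd p\<bar> \<bar>fst p - snd p\<bar>)) * of_bool (v = lat k l j c 0 0) +
      pmin (fst p) (fst p - snd p) * of_bool (v = lat k l j c 1 0) +
      pmin (snd p) (snd p - fst p) * of_bool (v = lat k l j c 0 1) +
      pmin (fst p) (snd p) * of_bool (v = lat k l j c 1 1) +
      pmin (- fst p) (snd p - fst p) * of_bool (v = lat k l j c (- 1) 0) +
      pmin (- snd p) (fst p - snd p) * of_bool (v = lat k l j c 0 (- 1)) +
      pmin (- fst p) (- snd p) * of_bool (v = lat k l j c (- 1) (- 1)))"
      unfolding pmin_def by (intro continuous_intros)
  qed (auto simp: bary_hexagon)
  have "isCont (\<lambda>p. bary k l j c (fst p) (snd p) v) p" for p v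
  proof -
    let ?a = "\<lfloor>fst p\<rfloor>" and ?b = "\<lfloor>snd p\<rfloor>"
    let ?q = "(of_int ?a, of_int ?b) :: real \<times> real"
    let ?H = "(\<lambda>p. p - ?q) -` hexagon"
    have "continuous_on ?H (\<lambda>p. bary k l j (c + ?a * int l + ?b * int j) (fst (p - ?q)) (snd (p - ?q)) v)"
      by (rule continuous_on_compose2[OF hex]) (auto intro!: continuous_intros)
    moreover have "bary k l j (c + ?a * int l + ?b * int j) (fst (p - ?q)) (snd (p - ?q)) v = bary k l j c (fst p) (snd p) v" for p
      by (subst bary_translate[symmetric]) simp
    ultimately have "continuous_on ?H (\<lambda>p. bary k l j c (fst p) (snd p) v)" by simp
    moreover have "open ?H" by (intro open_vimage open_hexagon continuous_intros)
    moreover have "p \<in> ?H" using hexagon_cover(1)[of "fst p" "snd p"] by (cases p) (simp add: frac_def)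
    ultimately show ?thesis by (simp add: continuous_on_eq_continuous_at)
  qed
  then show ?thesis
    by (intro continuous_on_coordinatewise_then_product continuous_at_imp_continuous_on) auto
qed

section \<open>Coordinates on the open star of a vertex\<close>

text \<open>Each of the two generators can have the given vertex in three positions, which yields
  six pairs of consecutive neighbours. The labels need not be distinct here, so the strip can use
  the result too.\<close>

lemma star_cases:
  assumes "k > 0" "x \<in> real_points (cyc k l j)" "x (lat k l j c 0 0) > 0"
  obtains a b where "{v. x v \<noteq> 0} \<subseteq> {lat k l j c 0 0, a, b}"
    "(a, b) \<in> {(lat k l j c 1 0, lat k l j c 1 1), (lat k l j c 0 1, lat k l j c 1 1),
       (lat k l j c (- 1) 0, lat k l j c 0 1), (lat k l j c 0 (- 1), lat k l j c 1 0),
       (lat k l j c (- 1) (- 1), lat k l j c 0 (- 1)), (lat k l j c (- 1) (- 1), lat k l j c (- 1) 0)}"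
proof -
  let ?S = "{v. x v \<noteq> 0}"
  have tri: "\<exists>m n. ?S \<subseteq> {vx k c, m, n} \<and> (m, n) \<in> {(vx k (c + int p), vx k (c + int p + int q)),
        (vx k (c - int p), vx k (c + int q)), (vx k (c - int p - int q), vx k (c - int q))}"
    if S: "?S \<subseteq> tri k p q z" for p q z
  proof -
    have eq: "tri k p q z = tri k p q z'" if "vx k z = vx k z'" for z'
    proof -
      have "z mod int k = z' mod int k" using that assms(1) by (metis int_vx)
      then show ?thesis using tri_mod[OF assms(1)] by metis
    qed
    have "vx k c \<in> ?S" using assms(3) by (simp add: lat_def)
    with S consider "vx k z = vx k c" | "vx k (z + int p) = vx k c" | "vx k (z + int p + int q) = vx k c"
      by (fastforce simp: tri_def)
    then show ?thesis
    proof cases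
      case 1
      then show ?thesis using S eq[OF 1] by (auto simp: tri_def)
    next
      case 2
      then have "vx k z = vx k (c - int p)" using assms(1) by (simp add: vx_eq_iff algebra_simps)
      from eq[OF this] S show ?thesis by (auto simp: tri_def insert_commute)
    next
      case 3
      then have "vx k z = vx k (c - int p - int q)" using assms(1) by (simp add: vx_eq_iff algebra_simps)
      from eq[OF this] S show ?thesis by (auto simp: tri_def insert_commute)
    qed
  qed
  have L: "lat k l j c 0 0 = vx k c" "lat k l j c 1 0 = vx k (c + int l)" "lat k l j c 0 1 = vx k (c + int j)"
    "lat k l j c 1 1 = vx k (c + int l + int j)" "lat k l j c (- 1) 0 = vx k (c - int l)"
    "lat k l j c 0 (- 1) = vx k (c - int j)" "lat k l j c (- 1) (- 1) = vx k (c - int l - int j)"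
    "vx k (c + int j + int l) = vx k (c + int l + int j)" "vx k (c - int j - int l) = vx k (c - int l - int j)"
    by (simp_all add: lat_def algebra_simps)
  have "?S \<in> cyc k l j" using assms(2) by (simp add: real_points_def)
  then obtain z where "?S \<subseteq> tri k l j z \<or> ?S \<subseteq> tri k j l z" unfolding mem_cyc by blast
  then show ?thesis
  proof
    assume "?S \<subseteq> tri k l j z"
    from tri[OF this] show ?thesis using that unfolding L by blast
  next
    assume "?S \<subseteq> tri k j l z"
    from tri[OF this] show ?thesis using that unfolding L by blast
  qed
qed

text \<open>The weighted sum of the plane coordinates of the six neighbours, the centre counting as
  the origin. It is linear in \<open>x\<close>, hence continuous.\<close>

definition hex_coord :: "nat \<Rightarrow> nat \<Rightarrow> nat \<Rightarrow> int \<Rightarrow> (nat \<Rightarrow> real) \<Rightarrow> real \<times> real" where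
  "hex_coord k l j c x =
     (x (lat k l j c 1 0) + x (lat k l j c 1 1) - x (lat k l j c (- 1) 0) - x (lat k l j c (- 1) (- 1)),
      x (lat k l j c 0 1) + x (lat k l j c 1 1) - x (lat k l j c 0 (- 1)) - x (lat k l j c (- 1) (- 1)))"

definition hex_distinct :: "nat \<Rightarrow> nat \<Rightarrow> nat \<Rightarrow> int \<Rightarrow> bool" where
  "hex_distinct k l j c \<longleftrightarrow> distinct [lat k l j c 0 0, lat k l j c 1 0, lat k l j c 0 1, lat k l j c 1 1,
     lat k l j c (- 1) 0, lat k l j c 0 (- 1), lat k l j c (- 1) (- 1)]"

text \<open>Packs the 21 inequalities of \<open>hex_distinct\<close> into a form that the simplifier
  decides by comparing coordinates.\<close>

lemma hex_lat_eq_iff: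
  assumes "hex_distinct k l j c"
    and "(a, b) \<in> {(0, 0), (1, 0), (0, 1), (1, 1), (- 1, 0), (0, - 1), (- 1, - 1)}"
    and "(a', b') \<in> {(0, 0), (1, 0), (0, 1), (1, 1), (- 1, 0), (0, - 1), (- 1, - 1)}"
  shows "lat k l j c a b = lat k l j c a' b' \<longleftrightarrow> a = a' \<and> b = b'"
proof -
  have "distinct (map (\<lambda>(a, b). lat k l j c a b)
      [(0, 0), (1, 0), (0, 1), (1, 1), (- 1, 0), (0, - 1), (- 1, - 1)])"
    using assms(1) unfolding hex_distinct_def by (simp only: list.map prod.case)
  then have "inj_on (\<lambda>(a, b). lat k l j c a b)
      {(0, 0), (1, 0), (0, 1), (1, 1), (- 1, 0), (0, - 1), (- 1, - 1)}"
    unfolding distinct_map by (simp only: list.set)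
  from inj_on_eq_iff[OF this assms(2,3)] show ?thesis by simp
qed

lemma pmin_diff:
  "pmin s (s - t) + pmin s t - pmin (- s) (t - s) - pmin (- s) (- t) = s"
  "pmin t (t - s) + pmin s t - pmin (- t) (s - t) - pmin (- s) (- t) = t"
  by (auto simp: pmin_def max_def min_def)

lemma hex_coord_bary:
  assumes "hex_distinct k l j c" "(s, t) \<in> hexagon"
  shows "hex_coord k l j c (bary k l j c s t) = (s, t)" "bary k l j c s t (lat k l j c 0 0) > 0"
proof -
  note d = hex_lat_eq_iff[OF assms(1)]
  have "bary k l j c s t (lat k l j c 0 0) = 1 - max \<bar>s\<bar> (max \<bar>t\<bar> \<bar>s - t\<bar>)"
    by (simp add: bary_hexagon[OF assms(2)] d)
  then show "bary k l j c s t (lat k l j c 0 0) > 0"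
    using assms(2) by (simp add: hexagon_def)
  have v: "bary k l j c s t (lat k l j c 1 0) = pmin s (s - t)"
    "bary k l j c s t (lat k l j c 0 1) = pmin t (t - s)"
    "bary k l j c s t (lat k l j c 1 1) = pmin s t"
    "bary k l j c s t (lat k l j c (- 1) 0) = pmin (- s) (t - s)"
    "bary k l j c s t (lat k l j c 0 (- 1)) = pmin (- t) (s - t)"
    "bary k l j c s t (lat k l j c (- 1) (- 1)) = pmin (- s) (- t)"
    by (simp_all add: bary_hexagon[OF assms(2)] d)
  show "hex_coord k l j c (bary k l j c s t) = (s, t)"
    unfolding hex_coord_def v pmin_diff ..
qed

text \<open>The support lies in one of six triangles; the other neighbours have weight zero, so
  \<open>hex_coord\<close> collapses to the coordinates of that sector.\<close>

lemma bary_hex_coord: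
  assumes "k > 0" "hex_distinct k l j c" "x \<in> real_points (cyc k l j)" "x (lat k l j c 0 0) > 0"
  shows "hex_coord k l j c x \<in> hexagon"
    "bary k l j c (fst (hex_coord k l j c x)) (snd (hex_coord k l j c x)) = x"
proof -
  have nn: "0 \<le> x v" for v using assms(3) by (simp add: real_points_def)
  obtain a b where ab: "{v. x v \<noteq> 0} \<subseteq> {lat k l j c 0 0, a, b}"
    "(a, b) \<in> {(lat k l j c 1 0, lat k l j c 1 1), (lat k l j c 0 1, lat k l j c 1 1),
       (lat k l j c (- 1) 0, lat k l j c 0 1), (lat k l j c 0 (- 1), lat k l j c 1 0),
       (lat k l j c (- 1) (- 1), lat k l j c 0 (- 1)), (lat k l j c (- 1) (- 1), lat k l j c (- 1) 0)}"
    using star_cases[OF assms(1,3,4)] by blast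
  have dist: "distinct [lat k l j c 0 0, a, b]"
    using ab(2) assms(2) unfolding hex_distinct_def by auto
  have z: "x v = 0" if "v \<noteq> lat k l j c 0 0" "v \<noteq> a" "v \<noteq> b" for v using ab(1) that by auto
  note pt = real_points_eq_pt3[OF assms(3) ab(1) dist]
  note hex = bary_sectors(1,3,5,7,9,11)[OF assms(4) nn nn pt(2)]
    and sec = bary_sectors(2,4,6,8,10,12)[OF assms(4) nn nn pt(2), of k l j c]
  note d = hex_lat_eq_iff[OF assms(2)]
  have "hex_coord k l j c x \<in> hexagon \<and>
    bary k l j c (fst (hex_coord k l j c x)) (snd (hex_coord k l j c x)) = x"
  proof -
    consider "a = lat k l j c 1 0" "b = lat k l j c 1 1" | "a = lat k l j c 0 1" "b = lat k l j c 1 1"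
      | "a = lat k l j c (- 1) 0" "b = lat k l j c 0 1" | "a = lat k l j c 0 (- 1)" "b = lat k l j c 1 0"
      | "a = lat k l j c (- 1) (- 1)" "b = lat k l j c 0 (- 1)"
      | "a = lat k l j c (- 1) (- 1)" "b = lat k l j c (- 1) 0"
      using ab(2) by auto
    then show ?thesis
    proof cases
      case 1
      then have eq: "hex_coord k l j c x = (x a + x b, x b)" by (simp add: hex_coord_def z d)
      then show ?thesis
        using hex(1) pt(1)[symmetric] 1 unfolding eq fst_conv snd_conv sec(1) by simp
    next
      case 2
      then have eq: "hex_coord k l j c x = (x b, x a + x b)" by (simp add: hex_coord_def z d)
      then show ?thesis
        using hex(2) pt(1)[symmetric] 2 unfolding eq fst_conv snd_conv sec(2) by simp
    next
      case 3
      then have eq: "hex_coord k l j c x = (- x a, x b)" by (simp add: hex_coord_def z d)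
      then show ?thesis
        using hex(3) pt(1)[symmetric] 3 unfolding eq fst_conv snd_conv sec(3) by simp
    next
      case 4
      then have eq: "hex_coord k l j c x = (x b, - x a)" by (simp add: hex_coord_def z d)
      then show ?thesis
        using hex(4) pt(1)[symmetric] 4 unfolding eq fst_conv snd_conv sec(4) by simp
    next
      case 5
      then have eq: "hex_coord k l j c x = (- x a, - x a - x b)" by (simp add: hex_coord_def z d)
      then show ?thesis
        using hex(5) pt(1)[symmetric] 5 unfolding eq fst_conv snd_conv sec(5) by simp
    next
      case 6
      then have eq: "hex_coord k l j c x = (- x a - x b, - x a)" by (simp add: hex_coord_def z d)
      then show ?thesis
        using hex(6) pt(1)[symmetric] 6 unfolding eq fst_conv snd_conv sec(6) by simp
    qed
  qed
  then show "hex_coord k l j c x \<in> hexagon"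
    "bary k l j c (fst (hex_coord k l j c x)) (snd (hex_coord k l j c x)) = x" by auto
qed

text \<open>For \<open>j = l\<close>, in the coordinates \<open>u = s + t\<close> along and \<open>w = s - t\<close> across the strip.\<close>

definition band :: "nat \<Rightarrow> nat \<Rightarrow> int \<Rightarrow> real \<Rightarrow> real \<Rightarrow> nat \<Rightarrow> real" where
  "band k l c u w = bary k l l c ((u + w) / 2) ((u - w) / 2)"

text \<open>The half of the hexagon with \<open>t \<le> s\<close>, in the coordinates
  \<open>(u, w)\<close>. The edge \<open>w = 0\<close> belongs to it and lies on the border of the
  half plane.\<close>

definition half_hexagon :: "(real \<times> real) set" where
  "half_hexagon = {(u, w). 0 \<le> w \<and> w < 1 \<and> \<bar>u\<bar> + w < 2}"

text \<open>Weighted sum of the \<open>(u, w)\<close>-positions \<open>(1, 1)\<close>,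
  \<open>(2, 0)\<close>, \<open>(-2, 0)\<close> and \<open>(-1, 1)\<close> of the neighbours
  \<open>(1, 0)\<close>, \<open>(1, 1)\<close>, \<open>(-1, -1)\<close> and
  \<open>(0, -1)\<close>.\<close>

definition band_coord :: "nat \<Rightarrow> nat \<Rightarrow> int \<Rightarrow> (nat \<Rightarrow> real) \<Rightarrow> real \<times> real" where
  "band_coord k l c x =
     (x (lat k l l c 1 0) + 2 * x (lat k l l c 1 1) - 2 * x (lat k l l c (- 1) (- 1)) - x (lat k l l c 0 (- 1)),
      x (lat k l l c 1 0) + x (lat k l l c 0 (- 1)))"

definition band_distinct :: "nat \<Rightarrow> nat \<Rightarrow> int \<Rightarrow> bool" where
  "band_distinct k l c \<longleftrightarrow> distinct [lat k l l c 0 0, lat k l l c 1 0, lat k l l c 1 1,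
     lat k l l c 0 (- 1), lat k l l c (- 1) (- 1)]"

lemma band_lat_eq_iff:
  assumes "band_distinct k l c"
    and "(a, b) \<in> {(0, 0), (1, 0), (1, 1), (0, - 1), (- 1, - 1)}"
    and "(a', b') \<in> {(0, 0), (1, 0), (1, 1), (0, - 1), (- 1, - 1)}"
  shows "lat k l l c a b = lat k l l c a' b' \<longleftrightarrow> a = a' \<and> b = b'"
proof -
  have "distinct (map (\<lambda>(a, b). lat k l l c a b) [(0, 0), (1, 0), (1, 1), (0, - 1), (- 1, - 1)])"
    using assms(1) unfolding band_distinct_def by (simp only: list.map prod.case)
  then have "inj_on (\<lambda>(a, b). lat k l l c a b) {(0, 0), (1, 0), (1, 1), (0, - 1), (- 1, - 1)}"
    unfolding distinct_map by (simp only: list.set)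
  from inj_on_eq_iff[OF this assms(2,3)] show ?thesis by simp
qed

lemma half_hexagonD:
  assumes "(u, w) \<in> half_hexagon"
  shows "((u + w) / 2, (u - w) / 2) \<in> hexagon"
  using assms by (auto simp: half_hexagon_def hexagon_def abs_less_iff abs_if field_simps split: if_splits)

lemma lat_swap: "lat k l l c 0 1 = lat k l l c 1 0" "lat k l l c (- 1) 0 = lat k l l c 0 (- 1)"
  by (simp_all add: lat_def)

lemma band_coord_band:
  assumes "band_distinct k l c" "(u, w) \<in> half_hexagon"
  shows "band_coord k l c (band k l c u w) = (u, w)" "band k l c u w (lat k l l c 0 0) > 0"
proof -
  let ?s = "(u + w) / 2" and ?t = "(u - w) / 2"
  note d = band_lat_eq_iff[OF assms(1)]
  note hex = half_hexagonD[OF assms(2)]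
  have st: "?s - ?t = w" "?t - ?s = - w" by (simp_all add: field_simps)
  have w: "0 \<le> w" using assms(2) by (simp add: half_hexagon_def)
  \<comment> \<open>The neighbours \<open>(0, 1)\<close> and \<open>(-1, 0)\<close> share their
    labels with \<open>(1, 0)\<close> and \<open>(0, -1)\<close>, but their hat functions vanish for
    \<open>w \<ge> 0\<close>, so they add nothing.\<close>
  have 0: "pmin ?t (- w) = 0" "pmin (- ?s) (- w) = 0" using w by (simp_all add: pmin_def)
  show "band k l c u w (lat k l l c 0 0) > 0"
  proof -
    have "band k l c u w (lat k l l c 0 0) = 1 - max \<bar>?s\<bar> (max \<bar>?t\<bar> \<bar>?s - ?t\<bar>)"
      by (simp only: band_def bary_hexagon[OF hex] lat_swap) (simp add: d)
    then show ?thesis using hex by (simp add: hexagon_def)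
  qed
  have v: "band k l c u w (lat k l l c 1 0) = pmin ?s w" "band k l c u w (lat k l l c 1 1) = pmin ?s ?t"
     "band k l c u w (lat k l l c 0 (- 1)) = pmin (- ?t) w"
     "band k l c u w (lat k l l c (- 1) (- 1)) = pmin (- ?s) (- ?t)"
    by (simp_all only: band_def bary_hexagon[OF hex] lat_swap st 0) (simp_all add: d)
  have p: "pmin (t + w) w + 2 * pmin (t + w) t - 2 * pmin (- (t + w)) (- t) - pmin (- t) w = 2 * t + w"
    "pmin (t + w) w + pmin (- t) w = w" for t
    using w by (auto simp: pmin_def max_def min_def)
  have e: "?t + w = ?s" "2 * ?t + w = u" by (simp_all add: field_simps)
  show "band_coord k l c (band k l c u w) = (u, w)"
    by (simp only: band_coord_def v p[of ?t, unfolded e])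
qed

lemma band_band_coord:
  assumes "k > 0" "band_distinct k l c" "x \<in> real_points (cyc k l l)" "x (lat k l l c 0 0) > 0"
  shows "band_coord k l c x \<in> half_hexagon"
    "band k l c (fst (band_coord k l c x)) (snd (band_coord k l c x)) = x"
proof -
  have nn: "0 \<le> x v" for v using assms(3) by (simp add: real_points_def)
  \<comment> \<open>Under \<open>lat_swap\<close> the six triangles around the vertex coincide in
    pairs.\<close>
  obtain a b where ab: "{v. x v \<noteq> 0} \<subseteq> {lat k l l c 0 0, a, b}"
    "(a, b) \<in> {(lat k l l c 1 0, lat k l l c 1 1), (lat k l l c 0 (- 1), lat k l l c 1 0),
       (lat k l l c (- 1) (- 1), lat k l l c 0 (- 1))}"
    using star_cases[OF assms(1,3,4)] unfolding lat_swap by blast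
  have dist: "distinct [lat k l l c 0 0, a, b]"
    using ab(2) assms(2) unfolding band_distinct_def by auto
  have z: "x v = 0" if "v \<noteq> lat k l l c 0 0" "v \<noteq> a" "v \<noteq> b" for v using ab(1) that by auto
  note pt = real_points_eq_pt3[OF assms(3) ab(1) dist]
  note hex = bary_sectors(1,3,5,7,9,11)[OF assms(4) nn nn pt(2)]
    and sec = bary_sectors(2,4,6,8,10,12)[OF assms(4) nn nn pt(2), of k l l c]
  note d = band_lat_eq_iff[OF assms(2)]
  have xa: "x a + x b < 1" "0 \<le> x a" "0 \<le> x b" using pt(2) assms(4) nn by auto
  have "band_coord k l c x \<in> half_hexagon \<and>
    band k l c (fst (band_coord k l c x)) (snd (band_coord k l c x)) = x"
  proof -
    consider "a = lat k l l c 1 0" "b = lat k l l c 1 1" | "a = lat k l l c 0 (- 1)" "b = lat k l l c 1 0"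
      | "a = lat k l l c (- 1) (- 1)" "b = lat k l l c 0 (- 1)"
      using ab(2) by auto
    then show ?thesis
    proof cases
      case 1
      then have eq: "band_coord k l c x = (x a + 2 * x b, x a)" by (simp add: band_coord_def z d)
      have h: "(x a + 2 * x b + x a) / 2 = x a + x b" "(x a + 2 * x b - x a) / 2 = x b" by simp_all
      have "band k l c (fst (band_coord k l c x)) (snd (band_coord k l c x)) = x"
        using pt(1)[symmetric] 1 unfolding eq fst_conv snd_conv band_def h sec(1) by simp
      then show ?thesis using xa by (simp add: eq half_hexagon_def)
    next
      case 2
      then have eq: "band_coord k l c x = (x b - x a, x a + x b)" by (simp add: band_coord_def z d)
      have h: "(x b - x a + (x a + x b)) / 2 = x b" "(x b - x a - (x a + x b)) / 2 = - x a" by simp_all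
      have "band k l c (fst (band_coord k l c x)) (snd (band_coord k l c x)) = x"
        using pt(1)[symmetric] 2 unfolding eq fst_conv snd_conv band_def h sec(4) by simp
      then show ?thesis using xa by (simp add: eq half_hexagon_def)
    next
      case 3
      then have eq: "band_coord k l c x = (- 2 * x a - x b, x b)" by (simp add: band_coord_def z d)
      have h: "(- 2 * x a - x b + x b) / 2 = - x a" "(- 2 * x a - x b - x b) / 2 = - x a - x b" by simp_all
      have "band k l c (fst (band_coord k l c x)) (snd (band_coord k l c x)) = x"
        using pt(1)[symmetric] 3 unfolding eq fst_conv snd_conv band_def h sec(5) by simp
      then show ?thesis using xa by (simp add: eq half_hexagon_def)
    qed
  qed
  then show "band_coord k l c x \<in> half_hexagon"
    "band k l c (fst (band_coord k l c x)) (snd (band_coord k l c x)) = x" by auto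
qed

section \<open>Distinctness of the labels around a vertex\<close>

text \<open>Up to sign the label differences are \<open>l\<close>, \<open>j\<close>,
  \<open>l + j\<close>, \<open>j - l\<close>, \<open>2l + j\<close> and \<open>l + 2j\<close>, all
  strictly between 0 and \<open>k\<close>, and the doubles of \<open>l\<close>, \<open>j\<close> and
  \<open>l + j\<close>, where oddness of \<open>k\<close> cancels the 2.\<close>

lemma hex_distinctI:
  assumes "0 < l" "l < j" "l + 2 * j < k" "odd k"
  shows "hex_distinct k l j c"
proof -
  have nd: "\<not> int k dvd x" if "0 < \<bar>x\<bar>" "\<bar>x\<bar> < int k" for x
    using that zdvd_not_zless[of "\<bar>x\<bar>" "int k"] by simp
  have n2: "\<not> int k dvd 2 * x" if "0 < \<bar>x\<bar>" "\<bar>x\<bar> < int k" for x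
  proof -
    have "coprime (int k) 2" using assms(4) by simp
    then show ?thesis using nd[OF that] by (simp add: coprime_dvd_mult_right_iff)
  qed
  have k: "k > 0" using assms by simp
  have n: "\<not> int k dvd int l" "\<not> int k dvd int j" "\<not> int k dvd int l + int j" "\<not> int k dvd int j - int l"
     "\<not> int k dvd 2 * int l + int j" "\<not> int k dvd int l + 2 * int j"
     "\<not> int k dvd 2 * int l" "\<not> int k dvd 2 * int j" "\<not> int k dvd 2 * (int l + int j)"
    subgoal by (rule nd) (use assms in auto)
    subgoal by (rule nd) (use assms in auto)
    subgoal by (rule nd) (use assms in auto)
    subgoal by (rule nd) (use assms in auto)
    subgoal by (rule nd) (use assms in auto)
    subgoal by (rule nd) (use assms in auto)
    subgoal by (rule n2) (use assms in auto)
    subgoal by (rule n2) (use assms in auto)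
    subgoal by (rule n2) (use assms in auto)
    done
  have E: "\<not> int k dvd z" if "\<not> int k dvd y" "z = y \<or> z = - y" for y z
    using that by auto
  have ne: "lat k l j c a b \<noteq> lat k l j c a' b'"
    if "\<not> int k dvd (a - a') * int l + (b - b') * int j" for a b a' b'
  proof -
    have "\<not> int k dvd (c + a * int l + b * int j) - (c + a' * int l + b' * int j)"
      using that by (simp add: algebra_simps)
    then show ?thesis using k by (simp add: lat_def vx_eq_iff)
  qed
  show ?thesis
    unfolding hex_distinct_def distinct.simps list.set insert_iff empty_iff de_Morgan_disj not_False_eq_True
    by (intro conjI TrueI ne; ((rule E[OF n(1)], simp; fail) | (rule E[OF n(2)], simp; fail)
      | (rule E[OF n(3)], simp; fail) | (rule E[OF n(4)], simp; fail) | (rule E[OF n(5)], simp; fail)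
      | (rule E[OF n(6)], simp; fail) | (rule E[OF n(7)], simp; fail) | (rule E[OF n(8)], simp; fail)
      | (rule E[OF n(9)], simp; fail)))
qed

text \<open>The labels are \<open>c\<close> plus the multiples of \<open>l\<close> by -2, ..., 2, so
  differences are multiples by 1 to 4; as \<open>k\<close> is prime to 2 and 3, all reduce to
  \<open>k\<close> not dividing \<open>l\<close>.\<close>

lemma band_distinctI:
  assumes "0 < l" "l < k" "odd k" "\<not> 3 dvd k"
  shows "band_distinct k l c"
proof -
  have k: "k > 0" using assms by simp
  have n1: "\<not> int k dvd int l" using assms(1,2) by (simp add: nat_dvd_not_less)
  have c2: "coprime (int k) 2" using assms(3) by simp
  have "coprime k 3" using assms(4) prime_imp_coprime[of 3 k] by (simp add: coprime_commute)
  then have c3: "coprime (int k) 3" by (metis coprime_int_iff of_nat_numeral)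
  have n: "\<not> int k dvd 2 * int l" "\<not> int k dvd 3 * int l" "\<not> int k dvd 2 * (2 * int l)"
    using n1 c2 c3 by (simp_all only: coprime_dvd_mult_right_iff not_False_eq_True)
  have ne: "lat k l l c a b \<noteq> lat k l l c a' b'" if "\<not> int k dvd ((a + b) - (a' + b')) * int l" for a b a' b'
  proof -
    have "(c + a * int l + b * int l) - (c + a' * int l + b' * int l) = ((a + b) - (a' + b')) * int l"
      by (simp add: algebra_simps)
    then show ?thesis using k that by (simp add: lat_def vx_eq_iff)
  qed
  show ?thesis
    unfolding band_distinct_def distinct.simps list.set insert_iff empty_iff de_Morgan_disj not_False_eq_True
    using n1 n by (intro conjI TrueI ne; simp)
qed

section \<open>Surfaces and tori\<close>

text \<open>Open vertex stars cover the realization, so one chart per star suffices; the separation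
  and countability axioms are inherited from the ambient product space.\<close>

lemma two_manifold_real_points:
  assumes chart: "\<And>x. x \<in> real_points K \<Longrightarrow> \<exists>v V L B. x v > 0 \<and> openin half_plane V \<and>
      continuous_on {y \<in> real_points K. y v > 0} L \<and> continuous_on V B \<and>
      (\<forall>y\<in>real_points K. y v > 0 \<longrightarrow> L y \<in> V \<and> B (L y) = y) \<and>
      (\<forall>p\<in>V. B p \<in> real_points K \<and> B p v > 0 \<and> L (B p) = p)"
  shows "two_manifold (realization K)"
  unfolding two_manifold_def realization_eq
proof (intro conjI ballI)
  let ?R = "real_points K"
  show "Hausdorff_space (top_of_set ?R)" by (simp add: Hausdorff_space_subtopology)
  obtain \<B> :: "(nat \<Rightarrow> real) set set" where B: "countable \<B>" "topological_basis \<B>"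
    using ex_countable_basis by blast
  show "second_countable_space (top_of_set ?R)"
    unfolding second_countable_space_def
  proof (intro exI conjI allI impI ballI)
    show "countable ((\<lambda>V. ?R \<inter> V) ` \<B>)" using B(1) by simp
    show "openin (top_of_set ?R) V" if "V \<in> (\<lambda>V. ?R \<inter> V) ` \<B>" for V
      using that topological_basis_open[OF B(2)] by auto
    fix U x assume U: "openin (top_of_set ?R) U \<and> x \<in> U"
    then obtain W where W: "open W" "U = ?R \<inter> W" by (auto simp: openin_open)
    moreover have "x \<in> W" using U W by simp
    ultimately obtain V where "V \<in> \<B>" "x \<in> V" "V \<subseteq> W" using topological_basisE[OF B(2)] by metis
    then show "\<exists>V\<in>(\<lambda>V. ?R \<inter> V) ` \<B>. x \<in> V \<and> V \<subseteq> U"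
      using W U by (intro bexI[of _ "?R \<inter> V"]) auto
  qed
  fix x assume "x \<in> topspace (top_of_set ?R)"
  then have x: "x \<in> ?R" by simp
  obtain v V L B where c: "x v > 0" "openin half_plane V"
     "continuous_on {y \<in> ?R. y v > 0} L" "continuous_on V B"
     "\<forall>y\<in>?R. y v > 0 \<longrightarrow> L y \<in> V \<and> B (L y) = y"
     "\<forall>p\<in>V. B p \<in> ?R \<and> B p v > 0 \<and> L (B p) = p"
    using chart[OF x] by (elim exE conjE)
  let ?U = "{y \<in> ?R. y v > 0}"
  have V: "V \<subseteq> {p. 0 \<le> snd p}" using openin_subset[OF c(2)] by (simp add: half_plane_def)
  have "open {y :: nat \<Rightarrow> real. y v > 0}"
    by (intro open_Collect_less continuous_on_product_coordinates continuous_intros)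
  then have "openin (top_of_set ?R) ?U" by (auto simp: openin_open)
  moreover have "subtopology (top_of_set ?R) ?U homeomorphic_space subtopology half_plane V"
  proof -
    have "?R \<inter> ?U = ?U" "{p. 0 \<le> snd p} \<inter> V = V" using V by blast+
    then have "subtopology (top_of_set ?R) ?U = top_of_set ?U" "subtopology half_plane V = top_of_set V"
      by (simp_all only: half_plane_def subtopology_subtopology)
    moreover have "L ` ?U \<subseteq> V" "B ` V \<subseteq> ?U" using c(5,6) by blast+
    then have "homeomorphic_maps (top_of_set ?U) (top_of_set V) L B"
      using c(3-6) by (simp add: homeomorphic_maps_def image_subset_iff_funcset)
    ultimately show ?thesis unfolding homeomorphic_space_def by auto
  qed
  ultimately show "\<exists>U V. openin (top_of_set ?R) U \<and> x \<in> U \<and> openin half_plane V \<and>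
      subtopology (top_of_set ?R) U homeomorphic_space subtopology half_plane V"
    using c(1,2) x by (intro exI[of _ ?U] exI[of _ V]) simp
qed

text \<open>Each quotient map factors through the other, and the two factors are mutually
  inverse.\<close>

lemma homeomorphic_space_by_fibres:
  assumes f: "quotient_map Q X f" and h: "quotient_map Q Y h"
    and fib: "\<And>p q. p \<in> topspace Q \<Longrightarrow> q \<in> topspace Q \<Longrightarrow> f p = f q \<longleftrightarrow> h p = h q"
  shows "X homeomorphic_space Y"
proof -
  obtain g where g: "continuous_map X Y g" "\<And>p. p \<in> topspace Q \<Longrightarrow> g (f p) = h p"
    using quotient_map_lift_exists[OF f quotient_imp_continuous_map[OF h]] fib by metis
  obtain e where e: "continuous_map Y X e" "\<And>p. p \<in> topspace Q \<Longrightarrow> e (h p) = f p"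
    using quotient_map_lift_exists[OF h quotient_imp_continuous_map[OF f]] fib by metis
  have "homeomorphic_maps X Y g e"
    unfolding homeomorphic_maps_def
    using g e quotient_imp_surjective_map[OF f] quotient_imp_surjective_map[OF h] by force
  then show ?thesis unfolding homeomorphic_space_def by blast
qed

lemma quotient_map_onto_real_points:
  assumes "compact Q" "continuous_on Q f" "f ` Q = real_points K"
  shows "quotient_map (top_of_set Q) (realization K) f"
  unfolding realization_eq
  by (rule T1_Spaces.continuous_imp_quotient_map)
    (use assms in \<open>auto simp: Hausdorff_space_subtopology compact_space_subtopology\<close>)

lemma continuous_on_hex_coord: "continuous_on S (hex_coord k l j c)"
  unfolding hex_coord_def
  by (intro continuous_intros continuous_on_subset[OF continuous_on_product_coordinates]) auto

lemma continuous_on_band_coord: "continuous_on S (band_coord k l c)"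
  unfolding band_coord_def
  by (intro continuous_intros continuous_on_subset[OF continuous_on_product_coordinates]) auto

lemma continuous_on_bary_compose:
  assumes "continuous_on S f" "continuous_on S g"
  shows "continuous_on S (\<lambda>p. bary k l j c (f p) (g p))"
  using continuous_on_compose2[OF continuous_on_bary[of UNIV], of S "\<lambda>p. (f p, g p)" k l j c] assms
  by (simp add: continuous_on_Pair)

lemma real_points_cyc_less:
  assumes "k > 0" "x \<in> real_points (cyc k l j)" "x v > 0"
  shows "v < k"
proof -
  have "{v. x v \<noteq> 0} \<in> cyc k l j" using assms(2) by (simp add: real_points_def)
  from cyc_subset[OF assms(1) this] have "v \<in> {..<k}" using assms(3) by (auto dest!: subsetD)
  then show ?thesis by simp
qed

lemma two_manifold_hex:
  assumes "k > 0" "\<And>c. hex_distinct k l j c"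
  shows "two_manifold (realization (cyc k l j))"
proof (rule two_manifold_real_points)
  let ?R = "real_points (cyc k l j)"
  fix x assume x: "x \<in> ?R"
  then obtain v where v: "x v > 0" by (rule real_points_pos)
  have "v < k"
    by (rule real_points_cyc_less[OF assms(1) x v])
  then have lat: "lat k l j (int v) 0 0 = v" by (simp add: lat_def)
  \<comment> \<open>The hexagon is raised by 1 to fit into the half plane; as
    \<open>\<bar>t\<bar> < 1\<close>, it stays off the border line.\<close>
  let ?V = "{p. (fst p, snd p - 1) \<in> hexagon}"
  let ?L = "\<lambda>y. (fst (hex_coord k l j (int v) y), snd (hex_coord k l j (int v) y) + 1)"
  let ?B = "\<lambda>p. bary k l j (int v) (fst p) (snd p - 1)"
  have "open ((\<lambda>p. (fst p, snd p - 1)) -` hexagon :: (real \<times> real) set)"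
    by (intro open_vimage open_hexagon continuous_intros)
  then have "openin half_plane ?V"
    unfolding half_plane_def openin_open
    by (intro exI[of _ "?V"]) (auto simp: vimage_def hexagon_def)
  moreover have "continuous_on {y \<in> ?R. y v > 0} ?L"
    by (intro continuous_intros continuous_on_hex_coord)
  moreover have "continuous_on ?V ?B"
    by (intro continuous_on_bary_compose continuous_intros)
  moreover have "\<forall>y\<in>?R. y v > 0 \<longrightarrow> ?L y \<in> ?V \<and> ?B (?L y) = y"
    using bary_hex_coord[OF assms(1) assms(2)[of "int v"]] unfolding lat by auto
  moreover have "\<forall>p\<in>?V. ?B p \<in> ?R \<and> ?B p v > 0 \<and> ?L (?B p) = p"
    using hex_coord_bary[OF assms(2)[of "int v"]] bary_in_cyc[OF assms(1)] unfolding lat by auto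
  ultimately show "\<exists>v V L B. x v > 0 \<and> openin half_plane V \<and>
      continuous_on {y \<in> ?R. y v > 0} L \<and> continuous_on V B \<and>
      (\<forall>y\<in>?R. y v > 0 \<longrightarrow> L y \<in> V \<and> B (L y) = y) \<and>
      (\<forall>p\<in>V. B p \<in> ?R \<and> B p v > 0 \<and> L (B p) = p)"
    using v by (intro exI conjI)
qed

lemma two_manifold_band:
  assumes "k > 0" "\<And>c. band_distinct k l c"
  shows "two_manifold (realization (cyc k l l))"
proof (rule two_manifold_real_points)
  let ?R = "real_points (cyc k l l)"
  fix x assume x: "x \<in> ?R"
  then obtain v where v: "x v > 0" by (rule real_points_pos)
  have "v < k"
    by (rule real_points_cyc_less[OF assms(1) x v])
  then have lat: "lat k l l (int v) 0 0 = v" by (simp add: lat_def)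
  let ?L = "band_coord k l (int v)"
  let ?B = "\<lambda>p. band k l (int v) (fst p) (snd p)"
  have "open {p :: real \<times> real. snd p < 1 \<and> \<bar>fst p\<bar> + snd p < 2}"
    by (intro open_Collect_conj open_Collect_less continuous_intros)
  then have "openin half_plane half_hexagon"
    unfolding half_plane_def openin_open by (auto simp: half_hexagon_def)
  moreover have "continuous_on {y \<in> ?R. y v > 0} ?L"
    by (rule continuous_on_band_coord)
  moreover have "continuous_on half_hexagon ?B"
    unfolding band_def by (intro continuous_on_bary_compose continuous_intros) auto
  moreover have "\<forall>y\<in>?R. y v > 0 \<longrightarrow> ?L y \<in> half_hexagon \<and> ?B (?L y) = y"
    using band_band_coord[OF assms(1) assms(2)[of "int v"]] unfolding lat by auto
  moreover have "\<forall>p\<in>half_hexagon. ?B p \<in> ?R \<and> ?B p v > 0 \<and> ?L (?B p) = p"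
    using band_coord_band[OF assms(2)[of "int v"]] bary_in_cyc[OF assms(1)] unfolding lat
    by (auto simp: band_def)
  ultimately show "\<exists>v V L B. x v > 0 \<and> openin half_plane V \<and>
      continuous_on {y \<in> ?R. y v > 0} L \<and> continuous_on V B \<and>
      (\<forall>y\<in>?R. y v > 0 \<longrightarrow> L y \<in> V \<and> B (L y) = y) \<and>
      (\<forall>p\<in>V. B p \<in> ?R \<and> B p v > 0 \<and> L (B p) = p)"
    using v by (intro exI conjI)
qed

section \<open>Fibres of the plane map and the torus\<close>

text \<open>A vertex of positive weight in the common image lifts to a lattice point near each
  preimage. The two lattice points have the same label, so after translation both preimages lie in
  one hexagon with one base label, where \<open>hex_coord\<close> shows that they agree.\<close>

lemma bary_eq_iff:
  assumes "k > 0" "\<And>c. hex_distinct k l j c"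
  shows "bary k l j c s t = bary k l j c s' t' \<longleftrightarrow>
    (\<exists>a b. s' = s + of_int a \<and> t' = t + of_int b \<and> int k dvd a * int l + b * int j)"
proof
  assume eq: "bary k l j c s t = bary k l j c s' t'"
  obtain v where v: "bary k l j c s t v > 0"
    using real_points_pos[OF bary_in_cyc[OF assms(1)]] by blast
  obtain a b where ab: "lat k l j c a b = v" "(s - of_int a, t - of_int b) \<in> hexagon"
    using bary_pos_hexagon[OF v] by blast
  obtain a' b' where ab': "lat k l j c a' b' = v" "(s' - of_int a', t' - of_int b') \<in> hexagon"
    using bary_pos_hexagon[of k l j c s' t' v] v eq by auto
  let ?c = "c + a * int l + b * int j" and ?c' = "c + a' * int l + b' * int j"
  have d: "int k dvd ?c' - ?c"
    using ab(1) ab'(1) assms(1) by (metis lat_def vx_eq_iff)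
  have 1: "bary k l j ?c (s - of_int a) (t - of_int b) = bary k l j c s t"
    by (subst bary_translate[symmetric]) simp
  have 2: "bary k l j ?c' (s' - of_int a') (t' - of_int b') = bary k l j c s' t'"
    by (subst bary_translate[symmetric]) simp
  have "bary k l j ?c (s - of_int a) (t - of_int b) = bary k l j ?c (s' - of_int a') (t' - of_int b')"
    using 1 2 eq bary_cong[OF assms(1) d] by simp
  then have "(s - of_int a, t - of_int b) = (s' - of_int a', t' - of_int b')"
    using hex_coord_bary(1)[OF assms(2) ab(2)] hex_coord_bary(1)[OF assms(2) ab'(2)] by metis
  then have "s' = s + of_int (a' - a) \<and> t' = t + of_int (b' - b)" by auto
  moreover have "int k dvd (a' - a) * int l + (b' - b) * int j" using d by (simp add: algebra_simps)
  ultimately show "\<exists>a b. s' = s + of_int a \<and> t' = t + of_int b \<and> int k dvd a * int l + b * int j" by blast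
next
  assume "\<exists>a b. s' = s + of_int a \<and> t' = t + of_int b \<and> int k dvd a * int l + b * int j"
  then obtain a b where ab: "s' = s + of_int a" "t' = t + of_int b" "int k dvd a * int l + b * int j" by blast
  then have "int k dvd (c + a * int l + b * int j) - c" by (simp add: add.assoc)
  from bary_cong[OF assms(1) this] show "bary k l j c s t = bary k l j c s' t'"
    unfolding ab(1,2) bary_translate by simp
qed

lemma bary_surj:
  assumes "k > 0" "\<And>c. hex_distinct k l j c" "x \<in> real_points (cyc_comp k l j c)"
  obtains s t where "x = bary k l j c s t"
proof -
  obtain v where v: "x v > 0" using real_points_pos[OF assms(3)] by blast
  have x: "x \<in> real_points (cyc k l j)" "{v. x v \<noteq> 0} \<subseteq> res_class k (gcd l (gcd j k)) c"
    using assms(3) by (auto simp: real_points_cyc_comp)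
  have "v \<in> res_class k (gcd l (gcd j k)) c" using x(2) v by auto
  then obtain a b where "v = vx k (c + a * int l + b * int j)" using res_class_lattice[OF assms(1)] by blast
  then have "v = lat k l j (c + a * int l + b * int j) 0 0" by (simp add: lat_def)
  with v have "bary k l j (c + a * int l + b * int j)
      (fst (hex_coord k l j (c + a * int l + b * int j) x))
      (snd (hex_coord k l j (c + a * int l + b * int j) x)) = x"
    using bary_hex_coord(2)[OF assms(1,2) x(1)] by blast
  then show ?thesis using that bary_translate by metis
qed

text \<open>\<open>A\<close> is \<open>k / gcd l k\<close>, the additive order of \<open>l\<close>
  modulo \<open>k\<close>.\<close>

lemma dvd_mult_period:
  fixes k l :: int
  assumes "k > 0"
  obtains A where "A > 0" "\<And>a. k dvd a * l \<longleftrightarrow> A dvd a"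
proof -
  have g: "gcd l k \<noteq> 0" using assms by simp
  obtain l' k' where lk: "l = l' * gcd l k" "k = k' * gcd l k" "coprime l' k'"
    using gcd_coprime_exists[OF g] by blast
  have "k' > 0" using lk(2) assms gcd_ge_0_int[of l k] by (metis zero_less_mult_pos2 g order_le_less)
  moreover have "k dvd a * l \<longleftrightarrow> k' dvd a" for a
  proof -
    have "k dvd a * l \<longleftrightarrow> k' * gcd l k dvd (a * l') * gcd l k" using lk(1,2) by (metis mult.assoc)
    also have "\<dots> \<longleftrightarrow> k' dvd a * l'" using g assms by simp
    also have "\<dots> \<longleftrightarrow> k' dvd a" using lk(3) by (simp add: coprime_dvd_mult_left_iff coprime_commute)
    finally show ?thesis .
  qed
  ultimately show ?thesis by (rule that)
qed

text \<open>A basis \<open>(A, 0), (a\<^sub>0, B)\<close> of the kernel of the map from \<open>\<int>\<^sup>2\<close> to \<open>\<int>\<^sub>k\<close>.\<close>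

lemma lattice_basis:
  fixes k l j :: int
  assumes "k > 0"
  obtains A B a0 where "A > 0" "B > 0"
    "\<And>a b. k dvd a * l + b * j \<longleftrightarrow> (\<exists>m n. a = m * A + n * a0 \<and> b = n * B)"
proof -
  obtain A where A: "A > 0" "\<And>a. k dvd a * l \<longleftrightarrow> A dvd a" using dvd_mult_period[OF assms] by blast
  have g: "gcd l k > 0" using assms by simp
  \<comment> \<open>A row of height \<open>b\<close> meets the kernel iff \<open>b * j\<close> is a
    multiple of \<open>l\<close> modulo \<open>k\<close>, that is, iff \<open>gcd l k\<close>
    divides it; \<open>B\<close> is the least positive such height.\<close>
  obtain B where B: "B > 0" "\<And>b. gcd l k dvd b * j \<longleftrightarrow> B dvd b" using dvd_mult_period[OF g] by blast
  obtain e where e: "B * j = gcd l k * e" using B(2)[of B] by auto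
  obtain x y where xy: "x * l + y * k = gcd l k" using bezout_int by blast
  \<comment> \<open>Bezout turns \<open>B * j\<close>, a multiple of the gcd, into a multiple of
    \<open>l\<close> modulo \<open>k\<close>; this gives the horizontal offset
    \<open>- e * x\<close> of the second basis vector.\<close>
  have "(- e * x) * l + B * j = k * (e * y)" unfolding e xy[symmetric] by (simp add: algebra_simps)
  then have a0: "k dvd (- e * x) * l + B * j" by simp
  have "k dvd a * l + b * j \<longleftrightarrow> (\<exists>m n. a = m * A + n * (- e * x) \<and> b = n * B)" for a b
  proof
    assume k: "k dvd a * l + b * j"
    then have "gcd l k dvd a * l + b * j" by (rule dvd_trans[OF gcd_dvd2])
    then have "gcd l k dvd b * j" by (simp add: dvd_add_right_iff)
    then obtain n where n: "b = n * B" using B(2) by (metis dvdE mult.commute)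
    have "k dvd (a * l + b * j) - n * ((- e * x) * l + B * j)" using k dvd_mult[OF a0] by (rule dvd_diff)
    then have "k dvd (a - n * (- e * x)) * l" by (simp add: n algebra_simps)
    then obtain m where "a - n * (- e * x) = A * m" using A(2) by (metis dvdE)
    then have "a = m * A + n * (- e * x)" by (simp add: algebra_simps)
    with n show "\<exists>m n. a = m * A + n * (- e * x) \<and> b = n * B" by blast
  next
    assume "\<exists>m n. a = m * A + n * (- e * x) \<and> b = n * B"
    then obtain m n where mn: "a = m * A + n * (- e * x)" "b = n * B" by blast
    have "k dvd (m * A) * l" using A(2) by simp
    then have "k dvd (m * A) * l + n * ((- e * x) * l + B * j)"
      using dvd_mult[OF a0] by (rule dvd_add)
    then show "k dvd a * l + b * j" by (simp add: mn algebra_simps)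
  qed
  with A(1) B(1) show ?thesis by (rule that)
qed

lemma cis_2pi_eq_iff: "cis (2 * pi * x) = cis (2 * pi * y) \<longleftrightarrow> (\<exists>n. y = x + of_int n)"
proof -
  have "cis (2 * pi * x) = cis (2 * pi * y) \<longleftrightarrow> (\<exists>n::int. 2 * pi * y = 2 * pi * x + 2 * pi * n)"
    using sin_cos_eq_iff[of "2 * pi * y" "2 * pi * x"] by (auto simp: complex_eq_iff)
  also have "\<dots> \<longleftrightarrow> (\<exists>n. y = x + of_int n)"
    by (simp flip: distrib_left)
  finally show ?thesis .
qed

lemma quotient_map_torus:
  "quotient_map (top_of_set unit_square) torus (\<lambda>p. (cis (2 * pi * fst p), cis (2 * pi * snd p)))"
proof (rule T1_Spaces.continuous_imp_quotient_map)
  let ?h = "\<lambda>p. (cis (2 * pi * fst p), cis (2 * pi * snd p))"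
  have "continuous_on unit_square (\<lambda>p. cis (2 * pi * fst p))" "continuous_on unit_square (\<lambda>p. cis (2 * pi * snd p))"
    unfolding cis_conv_exp by (intro continuous_intros)+
  then show "continuous_map (top_of_set unit_square) torus ?h"
    unfolding torus_def by (intro continuous_map_pairedI) (auto simp: continuous_map_in_subtopology)
  show "compact_space (top_of_set unit_square)"
    by (simp add: unit_square_def compact_space_subtopology compact_Times)
  show "Hausdorff_space torus"
    by (simp add: torus_def Hausdorff_space_prod_topology Hausdorff_space_subtopology)
  have "\<exists>x\<in>{0..1}. cis (2 * pi * x) = z" if "cmod z = 1" for z
  proof -
    have z: "z = cis (Arg2pi z)" using that by (metis complex_norm_eq_1_exp_eq cis_conv_exp Arg2pi_eq norm_one exp_eq_polar mult_1 of_real_1)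
    have "0 \<le> Arg2pi z" "Arg2pi z < 2 * pi" using Arg2pi_ge_0 Arg2pi_lt_2pi by auto
    then show ?thesis using z by (intro bexI[of _ "Arg2pi z / (2 * pi)"]) auto
  qed
  then show "?h ` topspace (top_of_set unit_square) = topspace torus"
    by (force simp: torus_def unit_square_def image_iff)
qed

text \<open>In coordinates with respect to the kernel basis the fibres are the integer translates,
  exactly the fibres of the pair of exponential maps.\<close>

lemma torus_component:
  assumes "k > 0" "\<And>c. hex_distinct k l j c"
  shows "realization (cyc_comp k l j c) homeomorphic_space torus"
proof -
  have k: "int k > 0" using assms(1) by simp
  obtain A B a0 where AB: "A > 0" "B > 0"
    "\<And>a b. int k dvd a * int l + b * int j \<longleftrightarrow> (\<exists>m n. a = m * A + n * a0 \<and> b = n * B)"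
    by (rule lattice_basis[OF k, of "int l" "int j"]) (rule that)
  \<comment> \<open>Carries the unit square to the parallelogram spanned by \<open>(A, 0)\<close>
    and \<open>(a0, B)\<close>, a fundamental domain of the kernel.\<close>
  let ?f = "\<lambda>p. bary k l j c (of_int A * fst p + of_int a0 * snd p) (of_int B * snd p)"
  let ?h = "\<lambda>p. (cis (2 * pi * fst p), cis (2 * pi * snd p))"
  have fib: "?f p = ?f q \<longleftrightarrow> ?h p = ?h q" for p q
  proof -
    have "?f p = ?f q \<longleftrightarrow> (\<exists>m n. fst q = fst p + of_int m \<and> snd q = snd p + of_int n)"
    proof
      assume "?f p = ?f q"
      then obtain a b where ab: "of_int A * fst q + of_int a0 * snd q = of_int A * fst p + of_int a0 * snd p + of_int a"
        "of_int B * snd q = of_int B * snd p + of_int b" "int k dvd a * int l + b * int j"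
        unfolding bary_eq_iff[OF assms] by blast
      obtain m n where mn: "a = m * A + n * a0" "b = n * B" using ab(3) AB(3) by blast
      have "of_int B * snd q = of_int B * (snd p + of_int n)" using ab(2) mn by (simp add: algebra_simps)
      then have q2: "snd q = snd p + of_int n" using AB(2) by simp
      have "of_int A * fst q = of_int A * (fst p + of_int m)" using ab(1) mn q2 by (simp add: algebra_simps)
      then have "fst q = fst p + of_int m" using AB(1) by simp
      with q2 show "\<exists>m n. fst q = fst p + of_int m \<and> snd q = snd p + of_int n" by blast
    next
      assume "\<exists>m n. fst q = fst p + of_int m \<and> snd q = snd p + of_int n"
      then obtain m n where mn: "fst q = fst p + of_int m" "snd q = snd p + of_int n" by blast
      have "int k dvd (m * A + n * a0) * int l + (n * B) * int j" unfolding AB(3) by blast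
      then show "?f p = ?f q" unfolding bary_eq_iff[OF assms]
        by (intro exI[of _ "m * A + n * a0"] exI[of _ "n * B"]) (simp add: mn algebra_simps)
    qed
    then show ?thesis by (simp add: cis_2pi_eq_iff)
  qed
  have surj: "x \<in> ?f ` unit_square" if x: "x \<in> real_points (cyc_comp k l j c)" for x
  proof -
    obtain s t where st: "x = bary k l j c s t" using bary_surj[OF assms x] by blast
    define y where "y = t / of_int B"
    define z where "z = (s - of_int a0 * y) / of_int A"
    have "x = ?f (z, y)" using AB(1,2) by (simp add: st y_def z_def)
    also have "\<dots> = ?f (frac z, frac y)"
    proof -
      have "frac z = z + of_int (- \<lfloor>z\<rfloor>)" "frac y = y + of_int (- \<lfloor>y\<rfloor>)"
        by (simp_all add: frac_def)
      then show ?thesis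
        using fib[of "(z, y)" "(frac z, frac y)"]
        unfolding fst_conv snd_conv prod.inject cis_2pi_eq_iff by blast
    qed
    finally have "x = ?f (frac z, frac y)" .
    moreover have "(frac z, frac y) \<in> unit_square"
      by (simp add: unit_square_def frac_lt_1 less_imp_le)
    ultimately show ?thesis by (rule image_eqI)
  qed
  show ?thesis
  proof (rule homeomorphic_space_by_fibres[OF _ quotient_map_torus])
    show "quotient_map (top_of_set unit_square) (realization (cyc_comp k l j c)) ?f"
    proof (rule quotient_map_onto_real_points)
      show "compact unit_square" by (simp add: unit_square_def compact_Times)
      show "continuous_on unit_square ?f" by (intro continuous_on_bary_compose continuous_intros)
      show "?f ` unit_square = real_points (cyc_comp k l j c)"
        using bary_in_cyc_comp[OF assms(1)] surj by blast
    qed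
  qed (rule fib)
qed

section \<open>Moebius strips\<close>

text \<open>The action across the strip of the \<open>n\<close>-th power of the glide reflection
  \<open>(u, w) \<mapsto> (u + 1, 1 - w)\<close>.\<close>

definition flip :: "int \<Rightarrow> real \<Rightarrow> real" where
  "flip n w = (if even n then w else 1 - w)"

lemma flip_flip: "flip m (flip n w) = flip (m + n) w"
  by (simp add: flip_def)

lemma flip_unit: "0 \<le> w \<Longrightarrow> w \<le> 1 \<Longrightarrow> 0 \<le> flip n w \<and> flip n w \<le> 1"
  by (simp add: flip_def)

text \<open>For \<open>n = 2 * m\<close> this is the lattice translation by \<open>(m, m)\<close>.
  For \<open>n = 2 * m + 1\<close> it is the swap followed by translation by
  \<open>(m + 1, m)\<close>, and the swap is what turns \<open>w\<close> into
  \<open>1 - w\<close>.\<close>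

lemma band_translate: "band k l c (u + of_int n) (flip n w) = band k l (c + n * int l) u w"
proof (cases "even n")
  case True
  then obtain m where n: "n = 2 * m" by blast
  have "(u + of_int n + w) / 2 = (u + w) / 2 + of_int m" "(u + of_int n - w) / 2 = (u - w) / 2 + of_int m"
    by (simp_all add: n field_simps)
  moreover have "c + n * int l = c + m * int l + m * int l" by (simp add: n)
  ultimately show ?thesis using True by (simp only: band_def flip_def if_True bary_translate)
next
  case False
  then obtain m where n: "n = 2 * m + 1" by (rule oddE)
  have e: "(u + of_int n + (1 - w)) / 2 = (u - w) / 2 + of_int (m + 1)"
    "(u + of_int n - (1 - w)) / 2 = (u + w) / 2 + of_int m"
    by (simp_all add: n field_simps)
  have c: "c + n * int l = c + (m + 1) * int l + m * int l" by (simp add: n algebra_simps)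
  have "band k l c (u + of_int n) (flip n w) = bary k l l (c + n * int l) ((u - w) / 2) ((u + w) / 2)"
    using False by (simp only: band_def flip_def if_False e bary_translate c)
  then show ?thesis by (simp add: band_def bary_swap)
qed

text \<open>In the strip the floors of \<open>s\<close> and \<open>t\<close> differ by 0 or 1, and
  which off-diagonal corner can carry weight depends on that difference. So the supporting vertex
  lies on one of the two border lines \<open>a = b\<close> and \<open>a = b + 1\<close>.\<close>

lemma bary_pos_strip:
  assumes "bary k l j c s t v > 0" "0 \<le> s - t" "s - t \<le> 1"
  obtains a b where "lat k l j c a b = v" "(s - of_int a, t - of_int b) \<in> hexagon" "a = b \<or> a = b + 1"
proof -
  have st: "s = of_int \<lfloor>s\<rfloor> + frac s" "t = of_int \<lfloor>t\<rfloor> + frac t" by (simp_all add: frac_def)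
  have fr: "0 \<le> frac s" "frac s < 1" "0 \<le> frac t" "frac t < 1" by (simp_all add: frac_lt_1)
  have "real_of_int (\<lfloor>s\<rfloor> - \<lfloor>t\<rfloor>) < 2" "real_of_int (\<lfloor>s\<rfloor> - \<lfloor>t\<rfloor>) > - 1" using assms(2,3) st fr by linarith+
  then have ab: "\<lfloor>s\<rfloor> = \<lfloor>t\<rfloor> \<or> \<lfloor>s\<rfloor> = \<lfloor>t\<rfloor> + 1" by linarith
  have less: "\<lfloor>s\<rfloor> = \<lfloor>t\<rfloor>" if "frac t < frac s"
  proof -
    have "real_of_int (\<lfloor>s\<rfloor> - \<lfloor>t\<rfloor>) < 1" using assms(3) st that by linarith
    then show ?thesis using ab by linarith
  qed
  have greater: "\<lfloor>s\<rfloor> = \<lfloor>t\<rfloor> + 1" if "frac s < frac t"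
  proof -
    have "real_of_int (\<lfloor>s\<rfloor> - \<lfloor>t\<rfloor>) > 0" using assms(2) st that by linarith
    then show ?thesis using ab by linarith
  qed
  show ?thesis
  proof (cases rule: bary_pos_cases[OF assms(1)])
    case 1
    show ?thesis
      by (rule that[of "\<lfloor>s\<rfloor>" "\<lfloor>t\<rfloor>"]) (use 1 ab hexagon_cover(1)[of s t] in \<open>auto simp: frac_def\<close>)
  next
    case 2
    show ?thesis
      by (rule that[of "\<lfloor>s\<rfloor> + 1" "\<lfloor>t\<rfloor>"])
        (use 2 less hexagon_cover(2)[of t s] in \<open>auto simp: frac_def algebra_simps\<close>)
  next
    case 3
    show ?thesis
      by (rule that[of "\<lfloor>s\<rfloor>" "\<lfloor>t\<rfloor> + 1"])
        (use 3 greater hexagon_cover(3)[of s t] in \<open>auto simp: frac_def algebra_simps\<close>)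
  next
    case 4
    show ?thesis
      by (rule that[of "\<lfloor>s\<rfloor> + 1" "\<lfloor>t\<rfloor> + 1"])
        (use 4 ab hexagon_cover(4)[of s t] in \<open>auto simp: frac_def algebra_simps\<close>)
  qed
qed

lemma hexagon_half_hexagon:
  assumes "(p, q) \<in> hexagon" "0 \<le> p - q"
  shows "(p + q, p - q) \<in> half_hexagon"
proof -
  have "p < 1" "- 1 < q" "p - q < 1" using assms(1) by (auto simp: hexagon_def)
  then show ?thesis using assms(2) by (auto simp: half_hexagon_def abs_if)
qed

text \<open>\<open>n = a + b\<close> numbers the lattice points of the strip along its length: even
  ones lie on \<open>w = 0\<close>, odd ones on \<open>w = 1\<close>. The flip brings the latter
  down to the straight edge of the half hexagon.\<close>

lemma band_pos:
  assumes "band k l c u w v > 0" "0 \<le> w" "w \<le> 1"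
  obtains n where "lat k l l (c + n * int l) 0 0 = v" "(u - of_int n, flip n w) \<in> half_hexagon"
proof -
  let ?s = "(u + w) / 2" and ?t = "(u - w) / 2"
  have w: "?s - ?t = w" "?s + ?t = u" by (simp_all add: field_simps)
  obtain a b where ab: "lat k l l c a b = v" "(?s - of_int a, ?t - of_int b) \<in> hexagon" "a = b \<or> a = b + 1"
    using bary_pos_strip[OF assms(1)[unfolded band_def]] assms(2,3) unfolding w by blast
  show ?thesis
  proof (rule that[of "a + b"])
    show "lat k l l (c + (a + b) * int l) 0 0 = v" using ab(1) by (simp add: lat_def algebra_simps)
    let ?p = "?s - of_int a" and ?q = "?t - of_int b"
    from ab(3) show "(u - of_int (a + b), flip (a + b) w) \<in> half_hexagon"
    proof
      assume "a = b"
      then have "u - of_int (a + b) = ?p + ?q" "flip (a + b) w = ?p - ?q"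
        by (simp_all add: flip_def field_simps)
      moreover have "?p - ?q = w" using \<open>a = b\<close> by (simp add: field_simps)
      ultimately show ?thesis
        using hexagon_half_hexagon[OF ab(2)] assms(2) by (simp only:)
    next
      assume "a = b + 1"
      then have "u - of_int (a + b) = ?q + ?p" "flip (a + b) w = ?q - ?p"
        by (simp_all add: flip_def field_simps)
      moreover have "?q - ?p = 1 - w" using \<open>a = b + 1\<close> by (simp add: field_simps)
      moreover have "(?q, ?p) \<in> hexagon" using ab(2) by (auto simp: hexagon_def abs_minus_commute)
      ultimately show ?thesis
        using hexagon_half_hexagon[of ?q ?p] assms(3) by (simp only: diff_ge_0_iff_ge)
    qed
  qed
qed

text \<open>Both points are moved by powers of the glide reflection into the half hexagon at a
  common supporting vertex, where \<open>band_coord\<close> separates points. Undoing one move and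
  composing with the other gives \<open>n\<close>.\<close>

lemma band_eq_iff:
  assumes "k > 0" "\<And>c. band_distinct k l c" "0 \<le> w" "w \<le> 1" "0 \<le> w'" "w' \<le> 1"
  shows "band k l c u w = band k l c u' w' \<longleftrightarrow>
    (\<exists>n. u' = u + of_int n \<and> w' = flip n w \<and> int k dvd n * int l)"
proof
  assume eq: "band k l c u w = band k l c u' w'"
  obtain v where v: "band k l c u w v > 0"
    using real_points_pos[OF bary_in_cyc[OF assms(1)]] unfolding band_def by blast
  obtain n where n: "lat k l l (c + n * int l) 0 0 = v" "(u - of_int n, flip n w) \<in> half_hexagon"
    using band_pos[OF v assms(3,4)] by blast
  obtain n' where n': "lat k l l (c + n' * int l) 0 0 = v" "(u' - of_int n', flip n' w') \<in> half_hexagon"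
    using band_pos[OF v[unfolded eq] assms(5,6)] by blast
  have "vx k (c + n' * int l) = vx k (c + n * int l)"
    using n(1) n'(1) by (simp add: lat_def)
  then have d: "int k dvd (c + n' * int l) - (c + n * int l)"
    unfolding vx_eq_iff[OF assms(1)] .
  have tr: "band k l (c + n * int l) (u - of_int n) (flip n w) = band k l c u w" for n u w
    by (subst band_translate[symmetric]) (simp add: flip_flip, simp add: flip_def)
  have "band k l (c + n * int l) (u - of_int n) (flip n w) = band k l (c + n * int l) (u' - of_int n') (flip n' w')"
    using tr[of n u w] tr[of n' u' w'] eq bary_cong[OF assms(1) d] by (simp add: band_def)
  then have "(u - of_int n, flip n w) = (u' - of_int n', flip n' w')"
    using band_coord_band(1)[OF assms(2) n(2)] band_coord_band(1)[OF assms(2) n'(2)] by metis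
  then have *: "u' = u + of_int (n' - n)" "flip n w = flip n' w'" by auto
  have "w' = flip n' (flip n' w')" unfolding flip_flip by (simp add: flip_def)
  also have "\<dots> = flip (n' - n) w" unfolding *(2)[symmetric] flip_flip by (simp add: flip_def)
  finally have "w' = flip (n' - n) w" .
  moreover have "int k dvd (n' - n) * int l" using d by (simp add: algebra_simps)
  ultimately show "\<exists>n. u' = u + of_int n \<and> w' = flip n w \<and> int k dvd n * int l" using *(1) by blast
next
  assume "\<exists>n. u' = u + of_int n \<and> w' = flip n w \<and> int k dvd n * int l"
  then obtain n where n: "u' = u + of_int n" "w' = flip n w" "int k dvd n * int l" by blast
  then have "int k dvd (c + n * int l) - c" by simp
  from bary_cong[OF assms(1) this] show "band k l c u w = band k l c u' w'"
    unfolding n(1,2) band_translate by (simp add: band_def)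
qed

lemma band_surj:
  assumes "k > 0" "\<And>c. band_distinct k l c" "x \<in> real_points (cyc_comp k l l c)"
  obtains u w where "x = band k l c u w" "0 \<le> w" "w \<le> 1"
proof -
  obtain v where v: "x v > 0" using real_points_pos[OF assms(3)] by blast
  have x: "x \<in> real_points (cyc k l l)" "{v. x v \<noteq> 0} \<subseteq> res_class k (gcd l (gcd l k)) c"
    using assms(3) by (auto simp: real_points_cyc_comp)
  have "v \<in> {v. x v \<noteq> 0}" using v by simp
  then have "v \<in> res_class k (gcd l (gcd l k)) c" using x(2) by blast
  then obtain a b where "v = vx k (c + a * int l + b * int l)" using res_class_lattice[OF assms(1)] by blast
  then have "v = lat k l l (c + (a + b) * int l) 0 0" by (simp add: lat_def algebra_simps)
  with v have *: "x (lat k l l (c + (a + b) * int l) 0 0) > 0" by simp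
  let ?p = "band_coord k l (c + (a + b) * int l) x"
  have p: "?p \<in> half_hexagon" "band k l (c + (a + b) * int l) (fst ?p) (snd ?p) = x"
    using band_band_coord[OF assms(1,2) x(1) *] by blast+
  show ?thesis
  proof (rule that)
    show "x = band k l c (fst ?p + of_int (a + b)) (flip (a + b) (snd ?p))"
      unfolding band_translate p(2) ..
    have "0 \<le> snd ?p" "snd ?p \<le> 1" using p(1) by (auto simp: half_hexagon_def)
    then show "0 \<le> flip (a + b) (snd ?p)" "flip (a + b) (snd ?p) \<le> 1" using flip_unit by auto
  qed
qed

lemma moebius_component:
  assumes "odd k" "\<And>c. band_distinct k l c"
  shows "realization (cyc_comp k l l c) homeomorphic_space moebius_strip"
proof -
  have k: "k > 0" using assms(1) by (auto intro: Nat.gr0I)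
  obtain A where A: "A > 0" "\<And>a. int k dvd a * int l \<longleftrightarrow> A dvd a"
    using dvd_mult_period[of "int k" "int l"] k of_nat_0_less_iff by blast
  have "A dvd int k" using A(2)[of "int k"] by simp
  \<comment> \<open>Oddness of \<open>A\<close> is why the ends are glued with a reversal:
    \<open>A * m\<close> and \<open>m\<close> have the same parity, so \<open>flip (A * m)\<close>
    equals \<open>flip m\<close>.\<close>
  then have "odd A" using assms(1) by (metis dvd_trans even_of_nat)
  \<comment> \<open>Stretches the square to a piece of the strip of length \<open>A\<close>, one
    period of the glide reflections that preserve labels.\<close>
  let ?f = "\<lambda>p. band k l c (of_int A * fst p) (snd p)"
  have fib: "?f p = ?f q \<longleftrightarrow> moebius_glue `` {p} = moebius_glue `` {q}"
    if pq: "p \<in> unit_square" "q \<in> unit_square" for p q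
  proof -
    obtain x y x' y' where xy: "p = (x, y)" "q = (x', y')" by (cases p, cases q)
    have sq: "0 \<le> x" "x \<le> 1" "0 \<le> y" "y \<le> 1" "0 \<le> x'" "x' \<le> 1" "0 \<le> y'" "y' \<le> 1"
      using pq by (auto simp: xy unit_square_def)
    have "?f p = ?f q \<longleftrightarrow> (\<exists>n. of_int A * x' = of_int A * x + of_int n \<and> y' = flip n y \<and> A dvd n)"
      using band_eq_iff[OF k assms(2) sq(3,4,7,8)] A(2) by (simp add: xy)
    also have "\<dots> \<longleftrightarrow> (\<exists>m. x' = x + of_int m \<and> y' = flip m y)"
    proof
      assume "\<exists>n. of_int A * x' = of_int A * x + of_int n \<and> y' = flip n y \<and> A dvd n"
      then obtain m where m: "of_int A * x' = of_int A * x + of_int (A * m)" "y' = flip (A * m) y"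
        unfolding dvd_def by blast
      have "of_int A * x' = of_int A * (x + of_int m)" using m(1) by (simp add: algebra_simps)
      then have "x' = x + of_int m" using A(1) by simp
      moreover have "y' = flip m y" using m(2) \<open>odd A\<close> by (simp add: flip_def)
      ultimately show "\<exists>m. x' = x + of_int m \<and> y' = flip m y" by blast
    next
      assume "\<exists>m. x' = x + of_int m \<and> y' = flip m y"
      then obtain m where "x' = x + of_int m" "y' = flip m y" by blast
      then show "\<exists>n. of_int A * x' = of_int A * x + of_int n \<and> y' = flip n y \<and> A dvd n"
        using \<open>odd A\<close> by (intro exI[of _ "A * m"]) (simp add: flip_def algebra_simps)
    qed
    also have "\<dots> \<longleftrightarrow> (p, q) \<in> moebius_glue"
    proof
      assume "\<exists>m. x' = x + of_int m \<and> y' = flip m y"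
      then obtain m where m: "x' = x + of_int m" "y' = flip m y" by blast
      then have "real_of_int m \<le> 1" "real_of_int m \<ge> - 1" using sq by linarith+
      \<comment> \<open>Both first coordinates lie in \<open>[0, 1]\<close>, so \<open>m = 1\<close>
        and \<open>m = -1\<close> force the two points onto opposite vertical sides.\<close>
      then have "m = 0 \<or> m = 1 \<or> m = - 1" by linarith
      then have "p = q \<or> {p, q} = {(0, y), (1, 1 - y)} \<or> {p, q} = {(0, y'), (1, 1 - y')}"
        using m sq by (auto simp: xy flip_def insert_commute)
      then show "(p, q) \<in> moebius_glue" using pq by (auto simp: moebius_glue_def)
    next
      assume "(p, q) \<in> moebius_glue"
      then consider "p = q" | z where "p = (0, z)" "q = (1, 1 - z)" | z where "p = (1, 1 - z)" "q = (0, z)"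
        by (auto simp: moebius_glue_def doubleton_eq_iff)
      then show "\<exists>m. x' = x + of_int m \<and> y' = flip m y"
      proof cases
        case 1 then show ?thesis by (intro exI[of _ 0]) (simp add: xy flip_def)
      next
        case 2 then show ?thesis by (intro exI[of _ 1]) (simp add: xy flip_def)
      next
        case 3 then show ?thesis by (intro exI[of _ "- 1"]) (simp add: xy flip_def)
      qed
    qed
    finally show ?thesis using eq_equiv_class_iff[OF equiv_moebius_glue pq] by simp
  qed
  have surj: "x \<in> ?f ` unit_square" if x: "x \<in> real_points (cyc_comp k l l c)" for x
  proof -
    obtain u w where uw: "x = band k l c u w" "0 \<le> w" "w \<le> 1" using band_surj[OF k assms(2) x] by blast
    define z where "z = u / of_int A"
    define n where "n = - (A * \<lfloor>z\<rfloor>)"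
    have w: "0 \<le> flip n w" "flip n w \<le> 1" using flip_unit[OF uw(2,3)] by auto
    have "of_int A * frac z = u + of_int n"
      using A(1) by (simp add: frac_def z_def n_def algebra_simps)
    moreover have "int k dvd n * int l" using A(2) by (simp add: n_def)
    ultimately have "x = ?f (frac z, flip n w)"
      unfolding uw(1) fst_conv snd_conv band_eq_iff[OF k assms(2) uw(2,3) w] by blast
    moreover have "(frac z, flip n w) \<in> unit_square"
      using w by (simp add: unit_square_def frac_lt_1 less_imp_le)
    ultimately show ?thesis by (rule image_eqI)
  qed
  show ?thesis
  proof (rule homeomorphic_space_by_fibres[OF _ quotient_map_moebius_strip])
    show "quotient_map (top_of_set unit_square) (realization (cyc_comp k l l c)) ?f"
    proof (rule quotient_map_onto_real_points)
      show "compact unit_square" by (simp add: unit_square_def compact_Times)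
      show "continuous_on unit_square ?f"
        unfolding band_def by (intro continuous_on_bary_compose continuous_intros) auto
      show "?f ` unit_square = real_points (cyc_comp k l l c)"
        using bary_in_cyc_comp[OF k] surj unfolding band_def by blast
    qed
  qed (use fib in simp)
qed

theorem theorem1p2:
  fixes k :: nat
  assumes "k > 1" and "k mod 6 = 1 \<or> k mod 6 = 5"
  shows "decomposes (skel 2 (full_simplex k)) (M_family k \<union> S_family k) \<and>
    real (card (M_family k)) = (real k - 1) / 2 \<and>
    (\<forall>l. 1 \<le> l \<and> l \<le> (k - 1) div 2 \<longrightarrow>
       collection_of moebius_strip (M_complex l k) \<and>
       card (complex_components (M_complex l k)) = gcd l k \<and>
       (\<forall>C\<in>complex_components (M_complex l k). \<forall>D\<in>complex_components (M_complex l k).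
          isomorphic_complexes C D) \<and>
       (\<forall>C\<in>complex_components (M_complex l k). card (verts C) = k div gcd l k)) \<and>
    real (card (S_family k)) = ((real k)\<^sup>2 - 6 * real k + 5) / 12 \<and>
    (\<forall>l j. 1 \<le> l \<and> l < j \<and> j < k - l - j \<longrightarrow>
       collection_of torus (S_complex l j k) \<and>
       card (complex_components (S_complex l j k)) = gcd l (gcd j k) \<and>
       (\<forall>C\<in>complex_components (S_complex l j k). card (verts C) = k div gcd l (gcd j k)))"
proof -
  have k: "k > 0" "\<not> 3 dvd k" "odd k" using assms by (simp, presburger+)
  have comp: "\<exists>c. C = cyc_comp k l j c" if "C \<in> complex_components (cyc k l j)" for C l j
    using that unfolding complex_components_cyc[OF k(1)] by blast
  have card: "card (verts C) = k div gcd l (gcd j k)" if "C \<in> complex_components (cyc k l j)" for C l j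
  proof -
    have "gcd l (gcd j k) dvd k" by (rule dvd_trans[OF gcd_dvd2 gcd_dvd2])
    then show ?thesis using comp[OF that] verts_cyc_comp[OF k(1)] card_res_class[OF k(1)] by metis
  qed
  have gcd: "gcd l (gcd l k) = gcd l k" for l by (simp add: gcd.assoc[symmetric])
  show ?thesis
  proof (intro conjI allI impI)
    show "decomposes (skel 2 (full_simplex k)) (M_family k \<union> S_family k)"
      by (rule decomposes_M_S[OF k(1,2)])
    show "real (card (M_family k)) = (real k - 1) / 2"
      using k(3) by (auto simp: card_M_family[OF k(1,2)] elim!: oddE)
    have "real_of_int (12 * int (card (S_family k))) = real_of_int ((int k)\<^sup>2 - 6 * int k + 5)"
      using card_S_family[OF assms(2)] by simp
    then show "real (card (S_family k)) = ((real k)\<^sup>2 - 6 * real k + 5) / 12" by simp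
  next
    fix l assume l: "1 \<le> l \<and> l \<le> (k - 1) div 2"
    then have "0 < l" "2 * l < k" by auto
    then have eq: "M_complex l k = cyc k l l" by (rule M_complex_eq_cyc)
    have d: "band_distinct k l c" for c
      using \<open>0 < l\<close> \<open>2 * l < k\<close> k by (intro band_distinctI) auto
    show "collection_of moebius_strip (M_complex l k)"
      unfolding collection_of_def eq
      using abstract_complex_cyc[OF k(1)] two_manifold_band[OF k(1) d] moebius_component[OF k(3) d] comp
      by metis
    show "card (complex_components (M_complex l k)) = gcd l k"
      unfolding eq using card_complex_components_cyc[OF k(1)] gcd by simp
    show "\<forall>C\<in>complex_components (M_complex l k). \<forall>D\<in>complex_components (M_complex l k). isomorphic_complexes C D"
      unfolding eq using comp isomorphic_cyc_comp[OF k(1)] by metis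
    show "\<forall>C\<in>complex_components (M_complex l k). card (verts C) = k div gcd l k"
      unfolding eq using card gcd by metis
  next
    fix l j assume l: "1 \<le> l \<and> l < j \<and> j < k - l - j"
    then have *: "0 < l" "l < j" "l + 2 * j < k" "0 < j" "l + j < k" by auto
    then have eq: "S_complex l j k = cyc k l j" by (intro S_complex_eq_cyc)
    have d: "hex_distinct k l j c" for c using hex_distinctI[OF *(1-3) k(3)] .
    show "collection_of torus (S_complex l j k)"
      unfolding collection_of_def eq
      using abstract_complex_cyc[OF k(1)] two_manifold_hex[OF k(1) d] torus_component[OF k(1) d] comp
      by metis
    show "card (complex_components (S_complex l j k)) = gcd l (gcd j k)"
      unfolding eq using card_complex_components_cyc[OF k(1)] .
    show "\<forall>C\<in>complex_components (S_complex l j k). card (verts C) = k div gcd l (gcd j k)"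
      unfolding eq using card by metis
  qed
qed

end
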